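(* Let $(R,\mathfrak m,k)$ be a one-dimensional local Noetherian domain with infinite residue field which is analytically irreducible and residually rational, let $I$ be an $\mathfrak m$-primary ideal of $R$ which is not principal, and let $\Lambda=\Lambda(I)$ be the blowing-up of $R$ along $I$, with $e=e(I)$, $\nu=\nu(I)$, $\rho=\rho(I)$. Let $[r_1,\dots,r_n]$ be the type sequence of $R$ and let $\Gamma\subseteq\{1,\dots,n\}$ and $d(R:\Lambda)$ be as defined in the context. Then: (1) $$2\rho=e\nu+\sum_{i\notin\Gamma}(r_i-1)-d(R:\Lambda)-l_R(\Lambda^{**}/\Lambda)-l_R\big((R:\Lambda)/I^{\nu}\big).$$ (2) The following facts are equivalent: (a) $2\rho=e\nu+\sum_{i\notin\Gamma}(r_i-1)$; (b) $R:\Lambda=I^{\nu}$ and $d(R:\Lambda)=0$.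
   Context: Setting: $K$ is the quotient field of $R$; the integral closure $\overline R$ of $R$ in $K$ is a finite $R$-module and a DVR with uniformizer $t$ (analytic irreducibility), and $k\simeq\overline R/t\overline R$ (residual rationality). $v:K\to\mathbb Z\cup\{\infty\}$ is the valuation of $\overline R$, $v(t)=1$. $l_R$ denotes length of $R$-modules. Fractional ideals are nonzero; for fractional ideals $J,L$ put $J:L=\{y\in K: yL\subseteq J\}$ and $J^{**}=R:(R:J)$. For a subset $S\subseteq K$, $v(S)=\{v(y):y\in S, y\neq0\}$. Blowing-up: $\Lambda(I)=\bigcup_{n\ge0}(I^n:I^n)$. An element $x\in I$ with $I^{n+1}=xI^n$ for $n\gg0$ is a minimal reduction of $I$. $e(I)=l_R(R/xR)=v(x)$ is the multiplicity; $\nu(I)$ (reduction exponent) is the least integer such that $I^{n+1}=xI^n$ for all $n\ge\nu(I)$; $\rho(I)=l_R(\Lambda/R)$ is the genus. One has $I^\nu\subseteq R:\Lambda$. Type sequence: let $\gamma_R=R:\overline R=t^c\overline R$, $c=l_R(\overline R/\gamma_R)$, $\delta=l_R(\overline R/R)$, $n=c-\delta$, and let $s_0=0<s_1<\dots<s_n=c$ be the first $n+1$ elements of $v(R)$. Put $R_i=\{y\in R: v(y)\ge s_i\}$ and $r_i=l_R\big((R:R_i)/(R:R_{i-1})\big)$ for $i=1,\dots,n$; the type sequence is $[r_1,\dots,r_n]$. $\Gamma=\{i\in\{1,\dots,n\}: s_{i-1}\in v(R:\Lambda)\}$, and $d(R:\Lambda)=l_R(\overline R/\Lambda^{**})-\sum_{i\in\Gamma}r_i$.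 Sums over $i\notin\Gamma$ range over $i\in\{1,\dots,n\}\setminus\Gamma$. *)

theory Defs
  imports
    "HOL-Algebra.Ideal_Product"
    "HOL-Algebra.QuotRing"
    "HOL-Algebra.Ring_Divisibility"
    "HOL-Algebra.Module"
    "HOL-Computational_Algebra.Polynomial"
    "HOL-Library.Infinite_Set"
    "HOL-Library.Extended_Nat"
begin

text \<open>
  The quotient field \<open>K\<close> is a type of class \<open>field\<close>; the domain \<open>R\<close>, its integral closure, the
  blowing-up and all fractional ideals are subsets of \<open>K\<close>. Ring-theoretic hypotheses about a
  subring \<open>A\<close> of \<open>K\<close> are HOL-Algebra notions applied to the record \<open>ring_on A\<close>.
\<close>

definition ring_on :: "'a::field set \<Rightarrow> 'a ring" where
  "ring_on A = \<lparr>carrier = A, monoid.mult = (*), one = 1, ring.zero = 0, add = (+)\<rparr>"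

definition field_module :: "('a::field, 'a) module" where
  "field_module = \<lparr>carrier = UNIV, monoid.mult = (*), one = 1, ring.zero = 0, add = (+),
                   module.smult = (*)\<rparr>"

abbreviation submod :: "'a::field set \<Rightarrow> 'a set \<Rightarrow> bool" where
  "submod R N \<equiv> submodule N (ring_on R) field_module"

definition finite_module :: "'a::field set \<Rightarrow> 'a set \<Rightarrow> bool" where
  "finite_module R N \<longleftrightarrow> (\<exists>B. finite B \<and> N = \<Inter>{H. submod R H \<and> B \<subseteq> H})"

text \<open>
  \<open>mod_length R N L\<close> is the length of the \<open>R\<close>-module \<open>N/L\<close>: submodules of \<open>N/L\<close> are the submodules
  of \<open>N\<close> containing \<open>L\<close>. Being \<open>nat\<close>-valued it is meaningful for modules of finite length only.
\<close>

definition mod_length :: "'a::field set \<Rightarrow> 'a set \<Rightarrow> 'a set \<Rightarrow> nat" where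
  "mod_length R N L = Sup {n. \<exists>C :: nat \<Rightarrow> 'a set. C 0 = L \<and> C n = N \<and>
      (\<forall>i\<le>n. submod R (C i)) \<and> (\<forall>i<n. C i \<subset> C (Suc i))}"

definition krull_dim :: "('a, 'b) ring_scheme \<Rightarrow> enat" where
  "krull_dim A = Sup {enat n | n. \<exists>P :: nat \<Rightarrow> 'a set.
      (\<forall>i\<le>n. primeideal (P i) A) \<and> (\<forall>i<n. P i \<subset> P (Suc i))}"

definition local_with :: "('a, 'b) ring_scheme \<Rightarrow> 'a set \<Rightarrow> bool" where
  "local_with A M \<longleftrightarrow> (\<forall>M'. maximalideal M' A \<longleftrightarrow> M' = M)"

definition quotient_field_is_UNIV :: "'a::field set \<Rightarrow> bool" where
  "quotient_field_is_UNIV R \<longleftrightarrow> (\<forall>y::'a. \<exists>a\<in>R. \<exists>b\<in>R. b \<noteq> 0 \<and> y = a / b)"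

definition primary_to :: "'a::field set \<Rightarrow> 'a set \<Rightarrow> 'a set \<Rightarrow> bool" where
  "primary_to R M Q \<longleftrightarrow> ideal Q (ring_on R) \<and> Q \<noteq> R \<and>
     (\<forall>a\<in>R. \<forall>b\<in>R. a * b \<in> Q \<longrightarrow> a \<in> Q \<or> (\<exists>n::nat. b ^ n \<in> Q)) \<and>
     {a \<in> R. \<exists>n::nat. a ^ n \<in> Q} = M"

definition int_closure :: "'a::field set \<Rightarrow> 'a set" where
  "int_closure R = {y. \<exists>p :: 'a poly. lead_coeff p = 1 \<and> (\<forall>i. Polynomial.coeff p i \<in> R) \<and>
                        Polynomial.poly p y = 0}"

definition dvr :: "('a, 'b) ring_scheme \<Rightarrow> bool" where
  "dvr A \<longleftrightarrow> principal_domain A \<and> (\<exists>M. local_with A M) \<and> \<not> Ring.field A"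

definition uniformizer :: "('a, 'b) ring_scheme \<Rightarrow> 'a \<Rightarrow> bool" where
  "uniformizer A t \<longleftrightarrow> t \<in> carrier A \<and> maximalideal (PIdl\<^bsub>A\<^esub> t) A"

definition analytically_irreducible :: "'a::field set \<Rightarrow> bool" where
  "analytically_irreducible R \<longleftrightarrow>
     finite_module R (int_closure R) \<and> dvr (ring_on (int_closure R))"

text \<open>
  The map \<open>x + M \<mapsto> x + t \<cdot> int_closure R\<close> of residue fields induced by the inclusion is an isomorphism.
\<close>

definition residually_rational :: "'a::field set \<Rightarrow> 'a set \<Rightarrow> 'a \<Rightarrow> bool" where
  "residually_rational R M t \<longleftrightarrow>
     (let B = ring_on (int_closure R); N = PIdl\<^bsub>B\<^esub> t
      in (\<lambda>C. C <+>\<^bsub>B\<^esub> N) \<in> ring_iso (ring_on R Quot M) (B Quot N))"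

text \<open>
  The valuation of \<open>int_closure R\<close> normalised by \<open>v(t) = 1\<close>. It is only used at nonzero
  elements; the convention \<open>v(0) = \<infinity>\<close> is spelled out where \<open>0\<close> matters.
\<close>

definition val :: "'a::field set \<Rightarrow> 'a \<Rightarrow> 'a \<Rightarrow> int" where
  "val R t y = (THE k. \<exists>u \<in> Units (ring_on (int_closure R)). y = u * t powi k)"

definition vals :: "'a::field set \<Rightarrow> 'a \<Rightarrow> 'a set \<Rightarrow> int set" where
  "vals R t S = {val R t y | y. y \<in> S \<and> y \<noteq> 0}"

definition colon :: "'a::field set \<Rightarrow> 'a set \<Rightarrow> 'a set" where
  "colon J L = {y. \<forall>z\<in>L. y * z \<in> J}"

definition bidual :: "'a::field set \<Rightarrow> 'a set \<Rightarrow> 'a set" where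
  "bidual R J = colon R (colon R J)"

primrec ideal_power :: "'a::field set \<Rightarrow> 'a set \<Rightarrow> nat \<Rightarrow> 'a set" where
  "ideal_power R I 0 = R"
| "ideal_power R I (Suc n) = I \<cdot>\<^bsub>ring_on R\<^esub> ideal_power R I n"

definition blowup :: "'a::field set \<Rightarrow> 'a set \<Rightarrow> 'a set" where
  "blowup R I = (\<Union>n. colon (ideal_power R I n) (ideal_power R I n))"

definition minimal_reduction :: "'a::field set \<Rightarrow> 'a set \<Rightarrow> 'a \<Rightarrow> bool" where
  "minimal_reduction R I x \<longleftrightarrow> x \<in> I \<and>
     (\<exists>N. \<forall>n\<ge>N. ideal_power R I (Suc n) = (*) x ` ideal_power R I n)"

text \<open>
  Multiplicity and reduction exponent are computed with one chosen minimal reduction; their values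
  do not depend on the choice.
\<close>

definition some_reduction :: "'a::field set \<Rightarrow> 'a set \<Rightarrow> 'a" where
  "some_reduction R I = (SOME x. minimal_reduction R I x)"

definition multiplicity_of :: "'a::field set \<Rightarrow> 'a set \<Rightarrow> nat" where
  "multiplicity_of R I = mod_length R R ((*) (some_reduction R I) ` R)"

definition reduction_exponent :: "'a::field set \<Rightarrow> 'a set \<Rightarrow> nat" where
  "reduction_exponent R I = (LEAST N. \<forall>n\<ge>N.
     ideal_power R I (Suc n) = (*) (some_reduction R I) ` ideal_power R I n)"

definition genus :: "'a::field set \<Rightarrow> 'a set \<Rightarrow> nat" where
  "genus R I = mod_length R (blowup R I) R"

definition ts_length :: "'a::field set \<Rightarrow> nat" where
  "ts_length R = mod_length R (int_closure R) (colon R (int_closure R))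
               - mod_length R (int_closure R) R"

definition sg_elem :: "'a::field set \<Rightarrow> 'a \<Rightarrow> nat \<Rightarrow> nat" where
  "sg_elem R t i = enumerate {m. int m \<in> vals R t R} i"

definition trunc :: "'a::field set \<Rightarrow> 'a \<Rightarrow> nat \<Rightarrow> 'a set" where
  "trunc R t i = {y \<in> R. y = 0 \<or> val R t y \<ge> int (sg_elem R t i)}"

text \<open>The entry \<open>r\<^sub>i\<close> of the type sequence, meant for \<open>1 \<le> i \<le> ts_length R\<close>.\<close>

definition type_seq :: "'a::field set \<Rightarrow> 'a \<Rightarrow> nat \<Rightarrow> nat" where
  "type_seq R t i = mod_length R (colon R (trunc R t i)) (colon R (trunc R t (i - 1)))"

text \<open>
  In the next two definitions \<open>L\<close> is the overring \<open>\<Lambda>\<close>: they are the set \<open>\<Gamma>\<close> and the integer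
  \<open>d(R:\<Lambda>)\<close>, which both depend on \<open>R:\<Lambda>\<close>.
\<close>

definition Gam :: "'a::field set \<Rightarrow> 'a \<Rightarrow> 'a set \<Rightarrow> nat set" where
  "Gam R t L = {i \<in> {1..ts_length R}. int (sg_elem R t (i - 1)) \<in> vals R t (colon R L)}"

definition d_inv :: "'a::field set \<Rightarrow> 'a \<Rightarrow> 'a set \<Rightarrow> int" where
  "d_inv R t L = int (mod_length R (int_closure R) (bidual R L))
               - (\<Sum>i\<in>Gam R t L. int (type_seq R t i))"

end

theory Submission
  imports Defs "HOL-Library.Set_Algebras"
begin

text \<open>
  Write \<open>R'\<close> for the integral closure, \<open>v\<close> for its valuation, \<open>x\<close> for a minimal reduction of \<open>I\<close> and
  \<open>q = R : \<Lambda>\<close>. Everything reduces to counting. Because \<open>R\<close> and \<open>R'\<close> have the same residue field, the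
  length of \<open>L / J\<close> is the number of values of \<open>L\<close> that are not values of \<open>J\<close> (\<open>mod_length_eq_card\<close>),
  so lengths of fractional ideals are additive and invariant under multiplication by an element.

  The blowing-up satisfies \<open>I\<^sup>\<nu> = x\<^sup>\<nu> \<Lambda>\<close> (\<open>P_eq\<close>), and \<open>e = v(x)\<close>. Hence the chain
  \<open>I\<^sup>\<nu> \<subseteq> q \<subseteq> R \<subseteq> \<Lambda>\<close> has length \<open>e \<nu>\<close>. Its middle piece \<open>R / q\<close> has length the number of \<open>i \<notin> \<Gamma>\<close>, as
  \<open>q\<close> contains the conductor and misses exactly the values \<open>s\<^sub>i\<^sub>-\<^sub>1\<close> with \<open>i \<notin> \<Gamma>\<close>
  (\<open>mod_length_R_ideal\<close>). On the other hand the duals \<open>R : R\<^sub>i\<close> climb from \<open>R\<close> to \<open>R'\<close>, so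
  \<open>r\<^sub>1 + \<dots> + r\<^sub>n\<close> is the length of \<open>R' / R\<close> (\<open>sum_type_seq\<close>), that is, of the chain
  \<open>R \<subseteq> \<Lambda> \<subseteq> \<Lambda>\<^sup>*\<^sup>* \<subseteq> R'\<close>. Adding the two resulting expressions for \<open>\<rho>\<close> gives the formula.

  The equivalence needs two more facts. First, \<open>d(R : \<Lambda>) \<ge> 0\<close>: for \<open>i \<in> \<Gamma>\<close> the quotient
  \<open>(R : R\<^sub>i) / (R : R\<^sub>i\<^sub>-\<^sub>1)\<close> embeds in \<open>(R : q\<^sub>i) / (R : q\<^sub>i\<^sub>-\<^sub>1)\<close>, where \<open>q\<^sub>i = q \<inter> R\<^sub>i\<close>, and the latter
  quotients add up to \<open>R' / \<Lambda>\<^sup>*\<^sup>*\<close> (\<open>type_seq_le\<close>, \<open>sum_type_seq_value_indices_le\<close>). So the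
  formula subtracts three nonnegative terms, which must all vanish if nothing is lost. Second,
  \<open>q = I\<^sup>\<nu>\<close> forces \<open>\<Lambda>\<^sup>*\<^sup>* = \<Lambda>\<close> (\<open>bidual_eq\<close>), so the length of \<open>\<Lambda>\<^sup>*\<^sup>* / \<Lambda>\<close> vanishes together with the
  length of \<open>q / I\<^sup>\<nu>\<close>.
\<close>

section \<open>Submodules of the quotient field\<close>

lemma submod_iff:
  "submod R N \<longleftrightarrow> 0 \<in> N \<and> (\<forall>y\<in>N. \<forall>z\<in>N. y + z \<in> N) \<and> (\<forall>y\<in>N. - y \<in> N) \<and>
     (\<forall>a\<in>R. \<forall>y\<in>N. a * y \<in> N)"
proof -
  have inv: "inv\<^bsub>add_monoid field_module\<^esub> y = - y" for y :: 'a
    unfolding m_inv_def field_module_def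
    by (rule the_equality) (simp_all add: eq_neg_iff_add_eq_0 add.commute)
  show ?thesis
    unfolding submodule_def submodule_axioms_def subgroup_def inv
    by (simp add: field_module_def ring_on_def) blast
qed

lemma submodD:
  assumes "submod R N"
  shows "0 \<in> N" "y \<in> N \<Longrightarrow> z \<in> N \<Longrightarrow> y + z \<in> N" "y \<in> N \<Longrightarrow> - y \<in> N"
    "a \<in> R \<Longrightarrow> y \<in> N \<Longrightarrow> a * y \<in> N" "y \<in> N \<Longrightarrow> z \<in> N \<Longrightarrow> y - z \<in> N"
  using assms unfolding submod_iff diff_conv_add_uminus by blast+

lemma submod_Int: "submod R J \<Longrightarrow> submod R L \<Longrightarrow> submod R (J \<inter> L)"
  by (simp add: submod_iff)

lemma submod_plus:
  assumes "submod R J" "submod R L"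
  shows "submod R (J + L)"
  unfolding submod_iff
proof (intro conjI ballI)
  show "0 \<in> J + L"
    using set_plus_intro[OF submodD(1)[OF assms(1)] submodD(1)[OF assms(2)]] by simp
next
  fix y z assume "y \<in> J + L" "z \<in> J + L"
  then obtain a b c d where *: "y = a + b" "z = c + d" "a \<in> J" "b \<in> L" "c \<in> J" "d \<in> L"
    by (auto elim!: set_plus_elim)
  have "(a + c) + (b + d) \<in> J + L"
    using * assms by (intro set_plus_intro submodD(2)) auto
  then show "y + z \<in> J + L" using * by (simp add: algebra_simps)
next
  fix y assume "y \<in> J + L"
  then obtain a b where *: "y = a + b" "a \<in> J" "b \<in> L" by (auto elim!: set_plus_elim)
  have "(- a) + (- b) \<in> J + L"
    using * assms by (intro set_plus_intro submodD(3)) auto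
  then show "- y \<in> J + L" using * by simp
next
  fix r y assume r: "r \<in> R" and "y \<in> J + L"
  then obtain a b where *: "y = a + b" "a \<in> J" "b \<in> L" by (auto elim!: set_plus_elim)
  have "r * a + r * b \<in> J + L"
    using * assms r by (intro set_plus_intro) (auto intro: submodD(4))
  then show "r * y \<in> J + L" using * by (simp add: algebra_simps)
qed

lemma subset_plus_left: "submod R L \<Longrightarrow> J \<subseteq> J + L"
  using submodD(1) by (metis add.right_neutral set_plus_intro subsetI)

lemma subset_plus_right: "submod R J \<Longrightarrow> L \<subseteq> J + L"
  using submodD(1) by (metis add.left_neutral set_plus_intro subsetI)

lemma plus_subset: "submod R H \<Longrightarrow> J \<subseteq> H \<Longrightarrow> L \<subseteq> H \<Longrightarrow> J + L \<subseteq> H"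
  using submodD(2) by (metis set_plus_elim subset_iff)

lemma submod_scale:
  assumes "submod R J"
  shows "submod R ((*) y ` J)"
proof -
  have "y * a + y * b = y * (a + b)" "- (y * a) = y * (- a)" "c * (y * a) = y * (c * a)" for a b c
    by (simp_all add: algebra_simps)
  then show ?thesis
    using submodD[OF assms] unfolding submod_iff ball_simps by (metis image_eqI mult_zero_right)
qed

lemma submod_colon: "submod R J \<Longrightarrow> submod R (colon J L)"
  by (auto simp: submod_iff colon_def algebra_simps)

lemma colon_antimono: "L \<subseteq> L' \<Longrightarrow> colon J L' \<subseteq> colon J L"
  by (auto simp: colon_def)

section \<open>Lengths as numbers of missing values\<close>

text \<open>
  The part of the hypotheses on which all length computations rest: the valuation, the fact that
  every residue class of its ring contains an element of \<open>R\<close>, and a common denominator.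
\<close>

locale branch =
  fixes R :: "'a::field set" and t :: 'a
  assumes zero_R: "0 \<in> R" and one_R: "1 \<in> R"
    and add_R: "a \<in> R \<Longrightarrow> b \<in> R \<Longrightarrow> a + b \<in> R"
    and uminus_R: "a \<in> R \<Longrightarrow> - a \<in> R"
    and mult_R: "a \<in> R \<Longrightarrow> b \<in> R \<Longrightarrow> a * b \<in> R"
    and val_mult: "y \<noteq> 0 \<Longrightarrow> z \<noteq> 0 \<Longrightarrow> val R t (y * z) = val R t y + val R t z"
    and val_add: "y \<noteq> 0 \<Longrightarrow> z \<noteq> 0 \<Longrightarrow> y + z \<noteq> 0 \<Longrightarrow>
      min (val R t y) (val R t z) \<le> val R t (y + z)"
    and t_nz: "t \<noteq> 0" and val_t: "val R t t = 1"
    and int_closure_eq: "int_closure R = {y. y = 0 \<or> 0 \<le> val R t y}"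
    and R_subset: "R \<subseteq> int_closure R"
    and residue: "b \<in> int_closure R \<Longrightarrow> \<exists>a\<in>R. b = a \<or> 1 \<le> val R t (b - a)"
    and denominator: "\<exists>w. w \<noteq> 0 \<and> (\<forall>b\<in>int_closure R. w * b \<in> R)"
begin

abbreviation v :: "'a \<Rightarrow> int" where "v \<equiv> val R t"

text \<open>The fractional ideal \<open>t\<^sup>k R'\<close> of the integral closure \<open>R'\<close>.\<close>

definition filt :: "int \<Rightarrow> 'a set" where
  "filt k = {y. y = 0 \<or> k \<le> v y}"

text \<open>
  Lying between two of the modules \<open>filt k\<close> is equivalent to being a nonzero fractional ideal, and it is
  the form in which this is used: it makes the set of values of \<open>L\<close> missing in \<open>J\<close> finite.
\<close>

definition fractional :: "'a set \<Rightarrow> bool" where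
  "fractional J \<longleftrightarrow> submod R J \<and> (\<exists>k. filt k \<subseteq> J) \<and> (\<exists>k. J \<subseteq> filt k)"

lemma v_one: "v 1 = 0"
  using val_mult[of 1 1] by simp

lemma v_minus: "v (- y) = v y"
proof (cases "y = 0")
  case False
  have "v (-1) = 0" using val_mult[of "-1" "-1"] v_one by simp
  then show ?thesis using val_mult[of "-1" y] False by simp
qed simp

lemma v_inverse: "y \<noteq> 0 \<Longrightarrow> v (inverse y) = - v y"
  using val_mult[of y "inverse y"] v_one by simp

lemma v_divide: "y \<noteq> 0 \<Longrightarrow> z \<noteq> 0 \<Longrightarrow> v (y / z) = v y - v z"
  by (simp add: divide_inverse val_mult v_inverse)

lemma v_power: "y \<noteq> 0 \<Longrightarrow> v (y ^ n) = int n * v y"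
  by (induct n) (auto simp: v_one val_mult algebra_simps)

lemma v_powi: "v (t powi k) = k"
  using t_nz val_t by (simp add: power_int_def v_power v_inverse flip: power_inverse)

lemma t_powi_nz: "t powi k \<noteq> 0"
  using t_nz by simp

lemma v_add_eq:
  assumes "y \<noteq> 0" "z = 0 \<or> v y < v z"
  shows "y + z \<noteq> 0 \<and> v (y + z) = v y"
proof (cases "z = 0")
  case False
  then have lt: "v y < v z" using assms by simp
  have nz: "y + z \<noteq> 0"
  proof
    assume "y + z = 0"
    then have "z = - y" by (simp add: add_eq_0_iff)
    then show False using lt v_minus by simp
  qed
  have "v y \<le> v (y + z)" using val_add[OF assms(1) False nz] lt by simp
  moreover have "min (v (y + z)) (v (- z)) \<le> v ((y + z) + - z)"
    by (rule val_add) (use nz False assms in auto)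
  ultimately show ?thesis using nz lt v_minus[of z] by simp
qed (use assms in simp)

lemma zero_filt [simp]: "0 \<in> filt k"
  by (simp add: filt_def)

lemma filt_iff: "y \<noteq> 0 \<Longrightarrow> y \<in> filt k \<longleftrightarrow> k \<le> v y"
  by (simp add: filt_def)

lemma filt_antimono: "j \<le> k \<Longrightarrow> filt k \<subseteq> filt j"
  by (auto simp: filt_def)

lemma int_closure_filt: "int_closure R = filt 0"
  by (simp add: int_closure_eq filt_def)

lemma R_filt: "R \<subseteq> filt 0"
  using R_subset by (simp add: int_closure_filt)

lemma filt_mult: "y \<in> filt j \<Longrightarrow> z \<in> filt k \<Longrightarrow> y * z \<in> filt (j + k)"
  by (cases "y = 0 \<or> z = 0") (auto simp: filt_iff val_mult)

lemma filt_add: "y \<in> filt k \<Longrightarrow> z \<in> filt k \<Longrightarrow> y + z \<in> filt k"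
  using val_add[of y z] by (cases "y = 0 \<or> z = 0 \<or> y + z = 0") (auto simp: filt_iff)

lemma filt_uminus: "y \<in> filt k \<Longrightarrow> - y \<in> filt k"
  by (auto simp: filt_def v_minus)

lemma filt_scale: "y \<noteq> 0 \<Longrightarrow> (*) y ` filt k = filt (v y + k)"
proof
  assume y: "y \<noteq> 0"
  show "(*) y ` filt k \<subseteq> filt (v y + k)"
    using y by (auto intro!: filt_mult simp: filt_iff)
  show "filt (v y + k) \<subseteq> (*) y ` filt k"
  proof
    fix z assume z: "z \<in> filt (v y + k)"
    have "inverse y * z \<in> filt (- v y + (v y + k))"
      using y z by (intro filt_mult) (auto simp: filt_iff v_inverse)
    then show "z \<in> (*) y ` filt k" using y by (auto intro!: image_eqI[where x = "inverse y * z"])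
  qed
qed

lemma submod_filt: "submod R (filt k)"
  using filt_add filt_uminus filt_mult[of _ 0 _ k] R_filt by (auto simp: submod_iff)

lemma filt_not_zero: "\<exists>y\<in>filt k. y \<noteq> 0"
  by (rule bexI[of _ "t powi k"]) (use t_powi_nz in \<open>auto simp: filt_def v_powi\<close>)

lemma fractional_filt: "fractional (filt k)"
  using submod_filt by (auto simp: fractional_def)

lemma submod_R: "submod R R"
  using zero_R add_R uminus_R mult_R by (simp add: submod_iff)

lemma fractional_R: "fractional R"
proof -
  obtain w where w: "w \<noteq> 0" "\<forall>b\<in>int_closure R. w * b \<in> R" using denominator by blast
  have "filt (v w + 0) \<subseteq> R"
    unfolding filt_scale[OF w(1), symmetric] using w(2) int_closure_filt by auto
  then show ?thesis using submod_R R_filt by (auto simp: fractional_def)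
qed

lemma fractional_submod: "fractional J \<Longrightarrow> submod R J"
  by (simp add: fractional_def)

lemma fractional_between:
  "fractional J \<Longrightarrow> fractional H \<Longrightarrow> submod R L \<Longrightarrow> J \<subseteq> L \<Longrightarrow> L \<subseteq> H \<Longrightarrow> fractional L"
  unfolding fractional_def by blast

lemma fractional_plus:
  assumes "fractional J" "fractional L"
  shows "fractional (J + L)"
proof -
  obtain k l where "J \<subseteq> filt k" "L \<subseteq> filt l" using assms by (auto simp: fractional_def)
  then have "J \<subseteq> filt (min k l)" "L \<subseteq> filt (min k l)"
    using filt_antimono[of "min k l" k] filt_antimono[of "min k l" l] by auto
  then have "J + L \<subseteq> filt (min k l)" by (rule plus_subset[OF submod_filt])
  moreover have "J \<subseteq> J + L" using subset_plus_left fractional_submod assms by blast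
  ultimately show ?thesis
    using fractional_between[OF assms(1) fractional_filt] submod_plus fractional_submod assms
    by blast
qed

lemma fractional_Int:
  assumes "fractional J" "fractional L"
  shows "fractional (J \<inter> L)"
proof -
  obtain k l where "filt k \<subseteq> J" "filt l \<subseteq> L" using assms by (auto simp: fractional_def)
  then have "filt (max k l) \<subseteq> J \<inter> L"
    using filt_antimono[of k "max k l"] filt_antimono[of l "max k l"] by auto
  then show ?thesis
    using assms submod_Int unfolding fractional_def by blast
qed

lemma fractional_scale:
  assumes "y \<noteq> 0" "fractional J"
  shows "fractional ((*) y ` J)"
proof -
  obtain k l where "filt k \<subseteq> J" "J \<subseteq> filt l" using assms by (auto simp: fractional_def)
  then have "filt (v y + k) \<subseteq> (*) y ` J" "(*) y ` J \<subseteq> filt (v y + l)"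
    using filt_scale[OF assms(1)] by blast+
  then show ?thesis
    using assms submod_scale unfolding fractional_def by blast
qed

lemma fractional_nonzero_submod:
  assumes "submod R J" "J \<subseteq> filt k" "y \<in> J" "y \<noteq> 0"
  shows "fractional J"
proof -
  have "(*) y ` R \<subseteq> J" using submodD(4)[OF assms(1)] assms(3) by (auto simp: mult.commute)
  then show ?thesis
    using fractional_between[OF fractional_scale[OF assms(4) fractional_R] fractional_filt assms(1)]
      assms(2) by blast
qed

lemma fractional_not_zero: "fractional J \<Longrightarrow> \<exists>y\<in>J. y \<noteq> 0"
  unfolding fractional_def using filt_not_zero by blast

lemma fractional_colon:
  assumes "fractional J" "fractional L"
  shows "fractional (colon J L)"
proof -
  obtain k l where kl: "filt k \<subseteq> J" "L \<subseteq> filt l" using assms by (auto simp: fractional_def)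
  have "filt (k - l) \<subseteq> colon J L"
    using kl filt_mult[of _ "k - l" _ l] by (fastforce simp: colon_def)
  moreover obtain z where z: "z \<in> L" "z \<noteq> 0" using fractional_not_zero assms(2) by blast
  obtain j where j: "J \<subseteq> filt j" using assms by (auto simp: fractional_def)
  have "colon J L \<subseteq> filt (j - v z)"
  proof
    fix y assume "y \<in> colon J L"
    then have "y * z \<in> filt j" using z j by (auto simp: colon_def)
    then have "y * z * inverse z \<in> filt (j + (- v z))"
      using z by (intro filt_mult) (auto simp: filt_iff v_inverse)
    then show "y \<in> filt (j - v z)" using z by (simp add: mult.assoc)
  qed
  ultimately show ?thesis
    using submod_colon fractional_submod assms(1) unfolding fractional_def by blast
qed

lemma vals_mono: "J \<subseteq> L \<Longrightarrow> vals R t J \<subseteq> vals R t L"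
  by (auto simp: vals_def)

lemma vals_filt: "vals R t (filt k) = {k..}"
proof -
  have "m \<in> vals R t (filt k)" if "k \<le> m" for m
    unfolding vals_def using that t_powi_nz
    by (auto simp: v_powi filt_def intro!: exI[of _ "t powi m"])
  then show ?thesis by (auto simp: vals_def filt_def)
qed

lemma vals_scale: "y \<noteq> 0 \<Longrightarrow> vals R t ((*) y ` J) = (+) (v y) ` vals R t J"
  unfolding vals_def by (auto simp: val_mult image_iff) (metis val_mult mult_eq_0_iff)

lemma finite_vals_diff:
  assumes "fractional J" "fractional L"
  shows "finite (vals R t L - vals R t J)"
proof -
  obtain k l where "filt k \<subseteq> J" "L \<subseteq> filt l" using assms by (auto simp: fractional_def)
  then have "{k..} \<subseteq> vals R t J" "vals R t L \<subseteq> {l..}"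
    using vals_mono vals_filt by metis+
  then have "l \<le> m \<and> \<not> k \<le> m" if "m \<in> vals R t L - vals R t J" for m
    using that by blast
  then have "vals R t L - vals R t J \<subseteq> {l..<k}" by (auto simp: not_le)
  then show ?thesis using finite_subset by blast
qed

text \<open>
  The quotient \<open>y / z\<close> is a unit of the valuation ring; since the residue fields agree, it is
  congruent to an element of \<open>R\<close>.
\<close>

lemma raise_value:
  assumes "y \<noteq> 0" "z \<noteq> 0" "v y = v z"
  obtains a where "a \<in> R" "y - a * z = 0 \<or> v y < v (y - a * z)"
proof -
  have "y / z \<in> int_closure R"
    using assms by (simp add: int_closure_filt filt_iff v_divide)
  then obtain a where a: "a \<in> R" "y / z = a \<or> 1 \<le> v (y / z - a)" using residue by blast
  have "v y < v (y - a * z)" if ne: "y - a * z \<noteq> 0"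
  proof -
    have ne': "y / z - a \<noteq> 0" using ne assms by (simp add: field_simps)
    have "y - a * z = z * (y / z - a)" using assms by (simp add: field_simps)
    then have "v (y - a * z) = v z + v (y / z - a)" using val_mult[OF assms(2) ne'] by simp
    then show ?thesis using a ne' assms by auto
  qed
  then show ?thesis using that a by blast
qed

text \<open>
  Raising the value of an element of \<open>L\<close> repeatedly, by subtracting elements of \<open>J\<close>, moves it into
  the power of the maximal ideal that \<open>J\<close> contains.
\<close>

lemma subset_if_vals_subset:
  assumes J: "fractional J" and L: "submod R L" and sub: "J \<subseteq> L"
    and vals: "vals R t L \<subseteq> vals R t J"
  shows "L \<subseteq> J"
proof -
  obtain k where k: "filt k \<subseteq> J" using J by (auto simp: fractional_def)
  have "y \<in> J" if "y \<in> L" for y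
    using that
  proof (induct "nat (k - v y)" arbitrary: y rule: less_induct)
    case less
    show ?case
    proof (cases "y \<in> filt k")
      case True
      then show ?thesis using k by blast
    next
      case False
      then have y: "y \<noteq> 0" "v y < k" by (auto simp: filt_def)
      then have "v y \<in> vals R t J" using vals less.prems by (auto simp: vals_def)
      then obtain z where z: "z \<in> J" "z \<noteq> 0" "v y = v z" by (auto simp: vals_def)
      obtain a where a: "a \<in> R" "y - a * z = 0 \<or> v y < v (y - a * z)"
        using raise_value[OF y(1) z(2,3)] by blast
      have az: "a * z \<in> J" using a z submodD(4)[OF fractional_submod[OF J]] by blast
      have "y - a * z \<in> L" using submodD(5)[OF L less.prems] az sub by blast
      then have "y - a * z \<in> J"
        using less.hyps[of "y - a * z"] a(2) y(2) submodD(1)[OF fractional_submod[OF J]] by fastforce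
      then have "y - a * z + a * z \<in> J"
        using az submodD(2)[OF fractional_submod[OF J]] by blast
      then show ?thesis by simp
    qed
  qed
  then show ?thesis by blast
qed

definition chain :: "nat \<Rightarrow> 'a set \<Rightarrow> 'a set \<Rightarrow> bool" where
  "chain n J L \<longleftrightarrow> (\<exists>C :: nat \<Rightarrow> 'a set. C 0 = J \<and> C n = L \<and>
      (\<forall>i\<le>n. submod R (C i)) \<and> (\<forall>i<n. C i \<subset> C (Suc i)))"

lemma mod_length_chain: "mod_length R L J = Sup {n. chain n J L}"
  by (simp add: mod_length_def chain_def)

lemma chain_0: "submod R J \<Longrightarrow> chain 0 J J"
  unfolding chain_def by (rule exI[of _ "\<lambda>_. J"]) simp

lemma chain_0_iff: "chain 0 J L \<Longrightarrow> J = L"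
  unfolding chain_def by auto

lemma chain_Suc:
  "chain (Suc n) J L \<longleftrightarrow> submod R J \<and> (\<exists>H. J \<subset> H \<and> chain n H L)"
proof
  assume "chain (Suc n) J L"
  then obtain C where C: "C 0 = J" "C (Suc n) = L" "\<forall>i\<le>Suc n. submod R (C i)"
    "\<forall>i<Suc n. C i \<subset> C (Suc i)" unfolding chain_def by blast
  have "chain n (C 1) L"
    unfolding chain_def by (rule exI[of _ "\<lambda>i. C (Suc i)"]) (use C in auto)
  moreover have "J \<subset> C 1" using C(1) C(4)[rule_format, of 0] by simp
  moreover have "submod R J" using C(1) C(3)[rule_format, of 0] by simp
  ultimately show "submod R J \<and> (\<exists>H. J \<subset> H \<and> chain n H L)" by blast
next
  assume "submod R J \<and> (\<exists>H. J \<subset> H \<and> chain n H L)"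
  then obtain H C where J: "submod R J" "J \<subset> H" and C: "C 0 = H" "C n = L"
    "\<forall>i\<le>n. submod R (C i)" "\<forall>i<n. C i \<subset> C (Suc i)"
    unfolding chain_def by blast
  show "chain (Suc n) J L"
    unfolding chain_def
    by (rule exI[of _ "case_nat J C"]) (use J C in \<open>auto split: nat.splits\<close>)
qed

lemma chain_subset: "chain n J L \<Longrightarrow> submod R J \<and> submod R L \<and> J \<subseteq> L"
proof (induct n arbitrary: J)
  case 0
  then show ?case unfolding chain_def by auto
next
  case (Suc n)
  then show ?case unfolding chain_Suc by blast
qed

lemma chain_le_card:
  assumes "chain n J L" "fractional J" "fractional L"
  shows "n \<le> card (vals R t L - vals R t J)"
  using assms(1,2)
proof (induct n arbitrary: J)
  case (Suc n)
  obtain H where H: "J \<subset> H" "chain n H L" using Suc.prems by (auto simp: chain_Suc)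
  have HL: "submod R H" "H \<subseteq> L" using chain_subset[OF H(2)] by auto
  have fH: "fractional H"
    using fractional_between[OF Suc.prems(2) assms(3) HL(1)] H HL by blast
  obtain m where m: "m \<in> vals R t H" "m \<notin> vals R t J"
    using subset_if_vals_subset[OF Suc.prems(2) HL(1)] H(1) by blast
  have "vals R t L - vals R t H \<subset> vals R t L - vals R t J"
    using m vals_mono[of J H] vals_mono[of H L] H(1) HL(2) by blast
  then have "card (vals R t L - vals R t H) < card (vals R t L - vals R t J)"
    using finite_vals_diff[OF Suc.prems(2) assms(3)] by (rule psubset_card_mono[rotated])
  then show ?case using Suc.hyps[OF H(2) fH] by simp
qed simp

text \<open>
  A chain that meets the bound: adjoin to \<open>J\<close> the elements of \<open>L\<close> of value at least the largest
  missing value \<open>m\<close>; this adds only the value \<open>m\<close>.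
\<close>

lemma chain_card:
  assumes "fractional J" "fractional L" "J \<subseteq> L"
  shows "chain (card (vals R t L - vals R t J)) J L"
  using assms(1,3)
proof (induct "card (vals R t L - vals R t J)" arbitrary: J)
  case 0
  have "vals R t L \<subseteq> vals R t J"
    using 0 finite_vals_diff[OF 0(2) assms(2)] by auto
  then have "L = J"
    using subset_if_vals_subset[OF 0(2) fractional_submod[OF assms(2)] 0(3)] 0(3) by blast
  then show ?case using chain_0 0 fractional_submod by simp
next
  case (Suc n)
  let ?D = "vals R t L - vals R t J"
  note J = fractional_submod[OF Suc.prems(1)] and L = fractional_submod[OF assms(2)]
  have fin: "finite ?D" using finite_vals_diff Suc.prems(1) assms(2) by blast
  define m where "m = Max ?D"
  have "?D \<noteq> {}" using Suc.hyps(2) by (metis card.empty nat.distinct(1))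
  then have m: "m \<in> ?D" unfolding m_def using fin by (rule Max_in[rotated])
  have m_max: "k \<le> m" if "k \<in> ?D" for k unfolding m_def using fin that by simp
  define H where "H = J + (L \<inter> filt m)"
  have sub: "submod R (L \<inter> filt m)" using submod_Int L submod_filt by blast
  have JH: "J \<subseteq> H" unfolding H_def using subset_plus_left[OF sub] .
  have HL: "H \<subseteq> L" unfolding H_def using plus_subset[OF L] Suc.prems(2) by blast
  have fH: "fractional H"
    using fractional_between[OF Suc.prems(1) assms(2) _ JH HL] submod_plus[OF J sub]
    unfolding H_def .
  have "vals R t H = insert m (vals R t J)"
  proof
    obtain y where y: "y \<in> L" "y \<noteq> 0" "v y = m" using m by (auto simp: vals_def)
    then have "y \<in> H"
      using subset_plus_right[OF J, of "L \<inter> filt m"] by (auto simp: H_def filt_def)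
    then have "m \<in> vals R t H" using y by (auto simp: vals_def)
    then show "insert m (vals R t J) \<subseteq> vals R t H" using vals_mono[OF JH] by blast
    show "vals R t H \<subseteq> insert m (vals R t J)"
    proof
      fix k assume "k \<in> vals R t H"
      then obtain w where w: "w \<in> H" "w \<noteq> 0" "k = v w" by (auto simp: vals_def)
      obtain y z where yz: "w = y + z" "y \<in> J" "z \<in> L" "z \<in> filt m"
        using w(1) unfolding H_def by (auto elim: set_plus_elim)
      show "k \<in> insert m (vals R t J)"
      proof (cases "m \<le> v w")
        case True
        have "v w \<in> vals R t L" using w HL by (auto simp: vals_def)
        then show ?thesis using m_max[of "v w"] True w by force
      next
        case False
        then have "- z = 0 \<or> v w < v (- z)" using yz by (auto simp: filt_def v_minus)
        from v_add_eq[OF w(2) this] have "y \<noteq> 0" "v y = v w" using yz by auto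
        then show ?thesis using yz w by (auto simp: vals_def)
      qed
    qed
  qed
  then have "vals R t L - vals R t H = ?D - {m}" by blast
  then have n: "n = card (vals R t L - vals R t H)" using Suc.hyps(2) m fin by simp
  have "J \<noteq> H" using m \<open>vals R t H = _\<close> by auto
  then have "chain (Suc n) J L"
    unfolding chain_Suc using Suc.hyps(1)[OF n fH HL] n J JH by auto
  then show ?case using Suc.hyps(2) by simp
qed

text \<open>
  By residual rationality every value of \<open>L\<close> missing in \<open>J\<close> contributes exactly one simple factor.
\<close>

theorem mod_length_eq_card:
  assumes "fractional J" "fractional L" "J \<subseteq> L"
  shows "mod_length R L J = card (vals R t L - vals R t J)"
  unfolding mod_length_chain
  by (rule cSup_eq_maximum) (use chain_card chain_le_card assms in auto)

lemma mod_length_trans: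
  assumes "fractional J" "fractional L" "fractional H" "J \<subseteq> L" "L \<subseteq> H"
  shows "mod_length R H J = mod_length R H L + mod_length R L J"
proof -
  have "vals R t H - vals R t J = (vals R t H - vals R t L) \<union> (vals R t L - vals R t J)"
    using vals_mono[OF assms(4)] vals_mono[OF assms(5)] by blast
  moreover have "(vals R t H - vals R t L) \<inter> (vals R t L - vals R t J) = {}" by blast
  ultimately show ?thesis
    using assms by (simp add: mod_length_eq_card order.trans[OF assms(4,5)] card_Un_disjoint finite_vals_diff)
qed

lemma mod_length_0:
  assumes "fractional J" "fractional L" "J \<subseteq> L" "mod_length R L J = 0"
  shows "L = J"
  using chain_0_iff[of J L] chain_card[OF assms(1-3)] assms by (simp add: mod_length_eq_card)

lemma mod_length_self: "fractional J \<Longrightarrow> mod_length R J J = 0"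
  by (simp add: mod_length_eq_card)

lemma mod_length_scale:
  assumes "y \<noteq> 0" "fractional J" "fractional L" "J \<subseteq> L"
  shows "mod_length R ((*) y ` L) ((*) y ` J) = mod_length R L J"
proof -
  have inj: "inj ((+) (v y))" by simp
  show ?thesis
    using assms
    by (simp add: mod_length_eq_card fractional_scale image_mono vals_scale
        image_set_diff[OF inj, symmetric] card_image)
qed

lemma mod_length_filt: "j \<le> k \<Longrightarrow> mod_length R (filt j) (filt k) = nat (k - j)"
proof -
  assume "j \<le> k"
  moreover have "{j..} - {k..} = {j..<k}" by auto
  ultimately show ?thesis
    by (simp add: mod_length_eq_card fractional_filt filt_antimono vals_filt)
qed

text \<open>
  Compare \<open>L\<close> with some \<open>filt k \<supseteq> L\<close>: both paths from \<open>filt k\<close> down to \<open>y L\<close> have the same length, and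
  the quotients \<open>filt k / L\<close> and \<open>y filt k / y L\<close> are isomorphic.
\<close>

lemma mod_length_scale_self:
  assumes "y \<noteq> 0" "0 \<le> v y" "fractional L" "(*) y ` L \<subseteq> L"
  shows "mod_length R L ((*) y ` L) = nat (v y)"
proof -
  obtain k where k: "L \<subseteq> filt k" using assms(3) by (auto simp: fractional_def)
  let ?F = "filt k"
  note fr = fractional_filt assms(3) fractional_scale[OF assms(1)]
  have yF: "(*) y ` ?F = filt (v y + k)" using filt_scale assms(1) by blast
  have "mod_length R ?F ((*) y ` L) = mod_length R ?F L + mod_length R L ((*) y ` L)"
    by (rule mod_length_trans) (use fr k assms in auto)
  moreover have "mod_length R ?F ((*) y ` L) =
      mod_length R ?F ((*) y ` ?F) + mod_length R ((*) y ` ?F) ((*) y ` L)"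
    by (rule mod_length_trans)
      (use fr k assms filt_antimono[of k "v y + k"] in \<open>auto simp flip: yF intro: image_mono\<close>)
  moreover have "mod_length R ((*) y ` ?F) ((*) y ` L) = mod_length R ?F L"
    by (rule mod_length_scale) (use fr k assms in auto)
  moreover have "mod_length R ?F ((*) y ` ?F) = nat (v y)"
    unfolding yF by (subst mod_length_filt) (use assms in auto)
  ultimately show ?thesis by simp
qed

text \<open>
  \<open>A / (A \<inter> P)\<close> embeds in \<open>Q / P\<close>: by the modular law, adding \<open>P\<close> keeps a chain between \<open>A \<inter> P\<close> and
  \<open>A\<close> strict.
\<close>

lemma chain_plus:
  assumes "chain n J A" "submod R P" "A \<inter> P \<subseteq> J"
  shows "chain n (J + P) (A + P)"
  using assms(1,3)
proof (induct n arbitrary: J)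
  case 0
  then show ?case
    using chain_0_iff[OF 0(1)] chain_subset[OF 0(1)] chain_0 submod_plus assms(2) by blast
next
  case (Suc n)
  obtain H where H: "J \<subset> H" "chain n H A" "submod R J" using Suc.prems by (auto simp: chain_Suc)
  have HA: "submod R H" "H \<subseteq> A" using chain_subset[OF H(2)] by auto
  have "J + P \<noteq> H + P"
  proof
    assume eq: "J + P = H + P"
    have "H \<subseteq> J"
    proof
      fix h assume h: "h \<in> H"
      then have "h \<in> J + P" using subset_plus_left[OF assms(2)] eq by blast
      then obtain y p where yp: "h = y + p" "y \<in> J" "p \<in> P" by (auto elim: set_plus_elim)
      have "h - y \<in> H" using submodD(5)[OF HA(1) h] yp H(1) by blast
      then have "p \<in> J" using yp HA Suc.prems(2) by auto
      then show "h \<in> J" using yp submodD(2)[OF H(3)] by blast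
    qed
    then show False using H(1) by blast
  qed
  moreover have "J + P \<subseteq> H + P" using H(1) by (intro set_plus_mono2) auto
  moreover have "chain n (H + P) (A + P)" using Suc.hyps[OF H(2)] Suc.prems(2) H(1) by blast
  ultimately show ?case unfolding chain_Suc using submod_plus[OF H(3) assms(2)] by blast
qed

lemma mod_length_Int_le:
  assumes A: "fractional A" and P: "fractional P" and Q: "fractional Q" and "A \<subseteq> Q" "P \<subseteq> Q"
  shows "mod_length R A (A \<inter> P) \<le> mod_length R Q P"
proof -
  note s = fractional_submod[OF A] fractional_submod[OF P]
  have fI: "fractional (A \<inter> P)" and fp: "fractional (A + P)"
    using fractional_Int fractional_plus A P by auto
  have "chain (mod_length R A (A \<inter> P)) (A \<inter> P) A"
    using chain_card[OF fI A] mod_length_eq_card[OF fI A] by simp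
  then have "chain (mod_length R A (A \<inter> P)) ((A \<inter> P) + P) (A + P)"
    by (rule chain_plus) (use s in auto)
  moreover have "(A \<inter> P) + P = P"
    using plus_subset[OF s(2), of "A \<inter> P" P] subset_plus_right[OF submod_Int[OF s], of P] by blast
  ultimately have "mod_length R A (A \<inter> P) \<le> card (vals R t (A + P) - vals R t P)"
    using chain_le_card[OF _ P fp] by simp
  also have "\<dots> \<le> card (vals R t Q - vals R t P)"
    using vals_mono[OF plus_subset[OF fractional_submod[OF Q] \<open>A \<subseteq> Q\<close> \<open>P \<subseteq> Q\<close>]]
    by (intro card_mono finite_vals_diff P Q) blast
  finally show ?thesis using mod_length_eq_card[OF P Q \<open>P \<subseteq> Q\<close>] by simp
qed

end

context branch
begin

section \<open>The type sequence\<close>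

abbreviation sem :: "nat set" where "sem \<equiv> {m. int m \<in> vals R t R}"

abbreviation sg :: "nat \<Rightarrow> nat" where "sg \<equiv> sg_elem R t"

text \<open>The exponent \<open>c\<close> in \<open>R : R' = t\<^sup>c R'\<close>.\<close>

definition conductor :: nat where
  "conductor = (SOME c. colon R (filt 0) = filt (int c))"

lemma one_filt_0: "1 \<in> filt 0"
  by (simp add: filt_def v_one)

text \<open>
  As an ideal of the valuation ring, \<open>R : R'\<close> is generated by any of its elements of least value.
\<close>

lemma colon_filt_conductor: "colon R (filt 0) = filt (int conductor)"
proof -
  have fr: "fractional (colon R (filt 0))" by (intro fractional_colon fractional_R fractional_filt)
  have sub: "colon R (filt 0) \<subseteq> filt 0"
    using R_filt one_filt_0 unfolding colon_def by fastforce
  obtain y where y: "y \<in> colon R (filt 0)" "y \<noteq> 0" using fractional_not_zero[OF fr] by blast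
  obtain z where z: "z \<in> colon R (filt 0) \<and> z \<noteq> 0"
    "\<And>w. w \<in> colon R (filt 0) \<and> w \<noteq> 0 \<Longrightarrow> nat (v z) \<le> nat (v w)"
    using ex_has_least_nat[of "\<lambda>w. w \<in> colon R (filt 0) \<and> w \<noteq> 0" y "\<lambda>w. nat (v w)"] y by blast
  have nonneg: "0 \<le> v w" if "w \<in> colon R (filt 0)" "w \<noteq> 0" for w
    using sub that filt_iff by blast
  have "colon R (filt 0) \<subseteq> filt (v z)"
  proof
    fix w assume w: "w \<in> colon R (filt 0)"
    show "w \<in> filt (v z)"
    proof (cases "w = 0")
      case False
      then show ?thesis using z(2)[of w] nonneg[of w] w filt_iff by simp
    qed simp
  qed
  moreover have "filt (v z + 0) \<subseteq> colon R (filt 0)"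
    unfolding filt_scale[OF conjunct2[OF z(1)], symmetric]
    using z(1) filt_mult[of _ 0 _ 0] by (auto simp: colon_def mult.assoc)
  ultimately have "colon R (filt 0) = filt (int (nat (v z)))"
    using nonneg z(1) by auto
  then show ?thesis unfolding conductor_def by (rule someI)
qed

lemma filt_conductor_R: "filt (int conductor) \<subseteq> R"
  using one_filt_0 by (force simp: colon_def simp flip: colon_filt_conductor)

lemma vals_R: "vals R t R = int ` sem"
proof -
  have "0 \<le> m" if "m \<in> vals R t R" for m
    using that vals_mono[OF R_filt] vals_filt by auto
  then show ?thesis by (auto simp: image_iff) (metis nonneg_int_cases)
qed

lemma conductor_le_sem: "conductor \<le> m \<Longrightarrow> m \<in> sem"
  using vals_mono[OF filt_conductor_R] by (auto simp: vals_filt)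

lemma infinite_sem: "infinite sem"
  by (rule infinite_super[OF _ infinite_Ici[of conductor]]) (use conductor_le_sem in auto)

lemma ts_length_card: "ts_length R = card {m \<in> sem. m < conductor}"
proof -
  have "{0..} - vals R t R = int ` ({..<conductor} - {m \<in> sem. m < conductor})"
  proof
    show "{0..} - vals R t R \<subseteq> int ` ({..<conductor} - {m \<in> sem. m < conductor})"
    proof
      fix k assume k: "k \<in> {0..} - vals R t R"
      then obtain m where m: "k = int m" using nonneg_int_cases by auto
      then have "m < conductor" using k conductor_le_sem[of m] by (auto simp: not_le[symmetric])
      then show "k \<in> int ` ({..<conductor} - {m \<in> sem. m < conductor})" using k m by auto
    qed
  qed auto
  then have "mod_length R (filt 0) R = conductor - card {m \<in> sem. m < conductor}"
    using mod_length_eq_card[OF fractional_R fractional_filt R_filt]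
    by (simp add: vals_filt card_image card_Diff_subset subset_iff)
  moreover have "card {m \<in> sem. m < conductor} \<le> card {..<conductor}"
    by (rule card_mono) auto
  ultimately show ?thesis
    by (simp add: ts_length_def int_closure_filt colon_filt_conductor mod_length_filt)
qed

lemma sg_mono: "i \<le> j \<Longrightarrow> sg i \<le> sg j"
  using infinite_sem by (simp add: sg_elem_def)

lemma sg_less_iff: "sg i < sg j \<longleftrightarrow> i < j"
  using infinite_sem by (simp add: sg_elem_def)

lemma sg_0: "sg 0 = 0"
proof -
  have "0 \<in> sem" using one_R v_one by (auto simp: vals_def intro: exI[of _ 1])
  then show ?thesis by (simp add: sg_elem_def enumerate_0 Least_eq_0)
qed

text \<open>
  The length \<open>n = c - \<delta>\<close> counts the elements of the value semigroup below the conductor, so \<open>s\<^sub>n = c\<close>.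
\<close>

lemma sem_below_conductor: "{m \<in> sem. m < conductor} = sg ` {..<ts_length R}"
  and sg_ts_length: "sg (ts_length R) = conductor"
proof -
  obtain k where k: "sg k = conductor"
    using enumerate_Ex[OF infinite_sem] conductor_le_sem[of conductor]
    unfolding sg_elem_def by auto
  have "{m \<in> sem. m < conductor} = sg ` {..<k}"
  proof
    show "{m \<in> sem. m < conductor} \<subseteq> sg ` {..<k}"
    proof
      fix m assume m: "m \<in> {m \<in> sem. m < conductor}"
      then obtain i where i: "sg i = m"
        using enumerate_Ex[OF infinite_sem] unfolding sg_elem_def by auto
      then have "i < k" using m sg_less_iff[of i k] by (simp add: k)
      then show "m \<in> sg ` {..<k}" using i by auto
    qed
    show "sg ` {..<k} \<subseteq> {m \<in> sem. m < conductor}"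
      using enumerate_in_set[OF infinite_sem] infinite_sem by (auto simp: sg_elem_def simp flip: k)
  qed
  moreover have "inj_on sg {..<k}"
    using inj_enumerate[OF infinite_sem] by (auto simp: sg_elem_def inj_on_def)
  ultimately have "ts_length R = k" using ts_length_card by (simp add: card_image)
  then show "{m \<in> sem. m < conductor} = sg ` {..<ts_length R}" "sg (ts_length R) = conductor"
    using k \<open>{m \<in> sem. m < conductor} = sg ` {..<k}\<close> by auto
qed

lemma trunc_eq: "trunc R t i = R \<inter> filt (int (sg i))"
  by (auto simp: trunc_def filt_def)

lemma trunc_0: "trunc R t 0 = R"
  using R_filt by (auto simp: trunc_eq sg_0)

lemma trunc_ts_length: "trunc R t (ts_length R) = filt (int conductor)"
  using filt_conductor_R by (auto simp: trunc_eq sg_ts_length)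

lemma trunc_Suc: "trunc R t (Suc i) \<subseteq> trunc R t i"
  using filt_antimono[of "int (sg i)" "int (sg (Suc i))"] sg_mono[of i "Suc i"]
  by (auto simp: trunc_eq)

text \<open>No value of \<open>R\<close> lies strictly between \<open>s\<^sub>i\<close> and \<open>s\<^sub>i\<^sub>+\<^sub>1\<close>.\<close>

lemma trunc_gap:
  assumes "y \<in> R" "y = 0 \<or> int (sg i) < v y"
  shows "y \<in> trunc R t (Suc i)"
proof (cases "y = 0")
  case False
  then have "v y \<in> vals R t R" using assms by (auto simp: vals_def)
  then obtain m where m: "v y = int m" "m \<in> sem" using vals_R by auto
  then obtain j where j: "sg j = m"
    using enumerate_Ex[OF infinite_sem] unfolding sg_elem_def by auto
  have "sg i < sg j" using m j assms False by simp
  then have "Suc i \<le> j" using sg_less_iff by simp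
  then show ?thesis using sg_mono[of "Suc i" j] m j assms False by (simp add: trunc_eq filt_iff)
qed (use assms in \<open>simp add: trunc_eq\<close>)

lemma fractional_trunc: "fractional (trunc R t i)"
  unfolding trunc_eq by (intro fractional_Int fractional_R fractional_filt)

lemma colon_R_R: "colon R R = R"
  using mult_R[of _ 1] mult_R one_R by (fastforce simp: colon_def)

text \<open>
  If \<open>y t\<^sup>c R' \<subseteq> R\<close>, then \<open>y t\<^sup>c \<in> R : R' = t\<^sup>c R'\<close>.
\<close>

lemma colon_R_filt: "colon R (filt (int conductor)) = filt 0"
proof
  show "filt 0 \<subseteq> colon R (filt (int conductor))"
    using filt_mult[of _ 0 _ "int conductor"] filt_conductor_R by (auto simp: colon_def)
  show "colon R (filt (int conductor)) \<subseteq> filt 0"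
  proof
    fix y assume y: "y \<in> colon R (filt (int conductor))"
    define z where "z = t powi (int conductor)"
    have z: "z \<noteq> 0" "v z = int conductor" unfolding z_def using t_powi_nz v_powi by blast+
    have "z * b \<in> filt (int conductor)" if "b \<in> filt 0" for b
      using filt_mult[of z "int conductor" b 0] that z by (simp add: filt_iff)
    then have "y * z \<in> colon R (filt 0)" using y by (simp add: colon_def mult.assoc)
    then have *: "y * z \<in> filt (int conductor)" by (simp add: colon_filt_conductor)
    show "y \<in> filt 0"
    proof (cases "y = 0")
      case False
      then show ?thesis using * z by (simp add: filt_iff val_mult)
    qed simp
  qed
qed

lemma R_subset_colon: "J \<subseteq> R \<Longrightarrow> R \<subseteq> colon R J"
  using mult_R by (auto simp: colon_def)

text \<open>
  The duals \<open>R : R\<^sub>i\<close> climb from \<open>R : R = R\<close> to \<open>R : t\<^sup>c R' = R'\<close>, where \<open>R'\<close> is the integral closure,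
  so the type sequence sums to the length of \<open>R' / R\<close>.
\<close>

lemma sum_type_seq_colon:
  "(\<Sum>i=1..m. type_seq R t i) = mod_length R (colon R (trunc R t m)) R"
proof (induct m)
  case 0
  then show ?case by (simp add: trunc_0 colon_R_R mod_length_self fractional_R)
next
  case (Suc m)
  have "mod_length R (colon R (trunc R t (Suc m))) R =
      mod_length R (colon R (trunc R t (Suc m))) (colon R (trunc R t m)) +
      mod_length R (colon R (trunc R t m)) R"
    by (intro mod_length_trans fractional_R fractional_colon fractional_trunc R_subset_colon
        colon_antimono trunc_Suc) (simp add: trunc_eq)
  then show ?case using Suc by (simp add: type_seq_def)
qed

lemma sum_type_seq: "(\<Sum>i=1..ts_length R. type_seq R t i) = mod_length R (filt 0) R"
  unfolding sum_type_seq_colon trunc_ts_length colon_R_filt ..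

text \<open>The set \<open>\<Gamma>\<close> of a fractional ideal \<open>q\<close>; for \<open>q = R : \<Lambda>\<close> it is \<open>Gam\<close>.\<close>

definition value_indices :: "'a set \<Rightarrow> nat set" where
  "value_indices q = {i \<in> {1..ts_length R}. int (sg (i - 1)) \<in> vals R t q}"

text \<open>
  A value of \<open>R\<close> missing in \<open>q\<close> is smaller than the conductor, so it is one of \<open>s\<^sub>0, \<dots>, s\<^sub>n\<^sub>-\<^sub>1\<close>.
\<close>

lemma mod_length_R_ideal:
  assumes q: "fractional q" "q \<subseteq> R" "filt (int conductor) \<subseteq> q"
  shows "mod_length R R q = card ({1..ts_length R} - value_indices q)"
proof -
  let ?f = "\<lambda>i. int (sg (i - 1))"
  have "vals R t R - vals R t q = ?f ` ({1..ts_length R} - value_indices q)"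
  proof
    show "vals R t R - vals R t q \<subseteq> ?f ` ({1..ts_length R} - value_indices q)"
    proof
      fix k assume k: "k \<in> vals R t R - vals R t q"
      then obtain m where m: "k = int m" "m \<in> sem" using vals_R by auto
      have "int m \<notin> {int conductor..}" using vals_mono[OF q(3)] k m unfolding vals_filt by blast
      then have "m \<in> sg ` {..<ts_length R}" using m sem_below_conductor by auto
      then obtain j where j: "m = sg j" "j < ts_length R" by auto
      then show "k \<in> ?f ` ({1..ts_length R} - value_indices q)"
        using k m by (intro image_eqI[of _ _ "Suc j"]) (auto simp: value_indices_def)
    qed
    show "?f ` ({1..ts_length R} - value_indices q) \<subseteq> vals R t R - vals R t q"
      using enumerate_in_set[OF infinite_sem] by (auto simp: value_indices_def sg_elem_def)
  qed
  moreover have "inj_on ?f ({1..ts_length R} - value_indices q)"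
  proof (rule inj_onI)
    fix i j assume ij: "i \<in> {1..ts_length R} - value_indices q" "j \<in> {1..ts_length R} - value_indices q"
      "?f i = ?f j"
    then have "i - 1 = j - 1"
      using inj_enumerate[OF infinite_sem] by (simp add: sg_elem_def inj_eq)
    then show "i = j" using ij by auto
  qed
  ultimately show ?thesis using mod_length_eq_card[OF q(1) fractional_R q(2)] by (simp add: card_image)
qed

text \<open>
  Compare the duals of \<open>R\<^sub>i\<close> with those of \<open>q\<^sub>i = q \<inter> R\<^sub>i\<close>. If \<open>s\<^sub>i\<^sub>-\<^sub>1\<close> is a value of \<open>q\<close>, then
  \<open>R\<^sub>i\<^sub>-\<^sub>1 = R\<^sub>i + q\<^sub>i\<^sub>-\<^sub>1\<close>, hence \<open>(R : R\<^sub>i) \<inter> (R : q\<^sub>i\<^sub>-\<^sub>1) = R : R\<^sub>i\<^sub>-\<^sub>1\<close> and \<open>r\<^sub>i\<close> is at most the length of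
  \<open>(R : q\<^sub>i) / (R : q\<^sub>i\<^sub>-\<^sub>1)\<close>.
\<close>

lemma type_seq_le:
  assumes q: "fractional q" "q \<subseteq> R" and i: "int (sg i) \<in> vals R t q"
  shows "type_seq R t (Suc i) \<le>
    mod_length R (colon R (q \<inter> trunc R t (Suc i))) (colon R (q \<inter> trunc R t i))"
proof -
  let ?A = "colon R (trunc R t (Suc i))" and ?P = "colon R (q \<inter> trunc R t i)"
    and ?Q = "colon R (q \<inter> trunc R t (Suc i))"
  have "?A \<inter> ?P = colon R (trunc R t i)"
  proof
    show "colon R (trunc R t i) \<subseteq> ?A \<inter> ?P"
      using colon_antimono trunc_Suc by (metis Int_lower2 le_inf_iff)
    obtain w where w: "w \<in> q" "w \<noteq> 0" "v w = int (sg i)" using i by (auto simp: vals_def)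
    show "?A \<inter> ?P \<subseteq> colon R (trunc R t i)"
    proof
      fix y assume y: "y \<in> ?A \<inter> ?P"
      have "y * z \<in> R" if z: "z \<in> trunc R t i" for z
      proof (cases "z = 0 \<or> int (sg i) < v z")
        case True
        then have "z \<in> trunc R t (Suc i)" using z trunc_gap by (simp add: trunc_eq)
        then show ?thesis using y by (simp add: colon_def)
      next
        case False
        then have "z \<noteq> 0" "v z = v w" using z w by (auto simp: trunc_eq filt_iff)
        then obtain a where a: "a \<in> R" "z - a * w = 0 \<or> v z < v (z - a * w)"
          using raise_value w by blast
        have aw: "a * w \<in> q" using a w submodD(4)[OF fractional_submod[OF q(1)]] by blast
        have zR: "z - a * w \<in> R"
          using submodD(5)[OF submod_R, of z "a * w"] z aw q(2) by (auto simp: trunc_eq)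
        then have "z - a * w \<in> trunc R t (Suc i)"
          using trunc_gap a(2) \<open>v z = v w\<close> w by simp
        then have 1: "y * (z - a * w) \<in> R" using y by (simp add: colon_def)
        have "w \<in> q \<inter> trunc R t i" using w q(2) by (auto simp: trunc_eq filt_iff)
        then have "a * (y * w) \<in> R" using y a mult_R by (auto simp: colon_def)
        from add_R[OF 1 this] show ?thesis by (simp add: algebra_simps)
      qed
      then show "y \<in> colon R (trunc R t i)" by (simp add: colon_def)
    qed
  qed
  moreover have "mod_length R ?A (?A \<inter> ?P) \<le> mod_length R ?Q ?P"
    using trunc_Suc[of i]
    by (intro mod_length_Int_le fractional_colon fractional_R fractional_Int fractional_trunc q
        colon_antimono) auto
  ultimately show ?thesis by (simp add: type_seq_def)
qed

text \<open>
  The duals \<open>R : q\<^sub>i\<close> climb from \<open>R : q\<close> to \<open>R'\<close>; the steps with \<open>i \<in> \<Gamma>\<close> alone account for the sum of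
  these \<open>r\<^sub>i\<close>. For \<open>q = R : \<Lambda>\<close>, where \<open>R : q = \<Lambda>\<^sup>*\<^sup>*\<close>, this says that \<open>d(R : \<Lambda>)\<close> is not negative.
\<close>

lemma sum_type_seq_value_indices_le:
  assumes q: "fractional q" "q \<subseteq> R" "filt (int conductor) \<subseteq> q"
  shows "(\<Sum>i\<in>value_indices q. type_seq R t i) \<le> mod_length R (filt 0) (colon R q)"
proof -
  let ?q = "\<lambda>i. q \<inter> trunc R t i"
  have fr: "fractional (colon R (?q i))" for i
    by (intro fractional_colon fractional_R fractional_Int fractional_trunc q)
  have "(\<Sum>i\<in>value_indices q \<inter> {1..m}. type_seq R t i) \<le> mod_length R (colon R (?q m)) (colon R q)"
    if "m \<le> ts_length R" for m
    using that
  proof (induct m)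
    case (Suc m)
    have "mod_length R (colon R (?q (Suc m))) (colon R q) =
        mod_length R (colon R (?q (Suc m))) (colon R (?q m)) + mod_length R (colon R (?q m)) (colon R q)"
      using trunc_Suc[of m]
      by (intro mod_length_trans fr fractional_colon fractional_R q colon_antimono) auto
    moreover have "(\<Sum>i\<in>value_indices q \<inter> {1..Suc m}. type_seq R t i) =
        (\<Sum>i\<in>value_indices q \<inter> {1..m}. type_seq R t i) +
        (if Suc m \<in> value_indices q then type_seq R t (Suc m) else 0)"
    proof (cases "Suc m \<in> value_indices q")
      case True
      then have "value_indices q \<inter> {1..Suc m} = insert (Suc m) (value_indices q \<inter> {1..m})" by auto
      then show ?thesis using True by simp
    next
      case False
      then have "value_indices q \<inter> {1..Suc m} = value_indices q \<inter> {1..m}"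
        by (auto simp: le_Suc_eq)
      then show ?thesis using False by simp
    qed
    moreover have "type_seq R t (Suc m) \<le> mod_length R (colon R (?q (Suc m))) (colon R (?q m))"
      if "Suc m \<in> value_indices q"
      using type_seq_le[OF q(1,2)] that by (simp add: value_indices_def)
    ultimately show ?case using Suc by (auto split: if_splits)
  qed simp
  from this[of "ts_length R"]
  have "(\<Sum>i\<in>value_indices q \<inter> {1..ts_length R}. type_seq R t i) \<le>
    mod_length R (colon R (?q (ts_length R))) (colon R q)" by simp
  moreover have "?q (ts_length R) = filt (int conductor)" using q(3) trunc_ts_length by auto
  moreover have "value_indices q \<inter> {1..ts_length R} = value_indices q"
    by (auto simp: value_indices_def)
  ultimately show ?thesis by (simp add: colon_R_filt)
qed

end

section \<open>The blowing-up\<close>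

locale branch_ideal = branch +
  fixes I :: "'a set"
  assumes submod_I: "submod R I" and I_R: "I \<subseteq> R" and I_nz: "\<exists>y\<in>I. y \<noteq> 0"
begin

abbreviation P :: "nat \<Rightarrow> 'a set" where "P \<equiv> ideal_power R I"

lemma ideal_prod_mult: "y \<in> J \<Longrightarrow> z \<in> L \<Longrightarrow> y * z \<in> J \<cdot>\<^bsub>ring_on R\<^esub> L"
  using ideal_prod.prod[of y J z L "ring_on R"] by (simp add: ring_on_def)

lemma ideal_prod_add:
  "y \<in> J \<cdot>\<^bsub>ring_on R\<^esub> L \<Longrightarrow> z \<in> J \<cdot>\<^bsub>ring_on R\<^esub> L \<Longrightarrow> y + z \<in> J \<cdot>\<^bsub>ring_on R\<^esub> L"
  using ideal_prod.sum[of y "ring_on R" J L z] by (simp add: ring_on_def)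

lemma ideal_prod_induct [consumes 1, case_names mult add]:
  assumes "s \<in> J \<cdot>\<^bsub>ring_on R\<^esub> L"
    and "\<And>y z. y \<in> J \<Longrightarrow> z \<in> L \<Longrightarrow> Q (y * z)" and "\<And>y z. Q y \<Longrightarrow> Q z \<Longrightarrow> Q (y + z)"
  shows "Q s"
  using assms(1) by induct (use assms(2,3) in \<open>auto simp: ring_on_def\<close>)

lemma submod_ideal_prod:
  assumes J: "submod R J" and L: "submod R L"
  shows "submod R (J \<cdot>\<^bsub>ring_on R\<^esub> L)"
proof -
  have smult: "a * s \<in> J \<cdot>\<^bsub>ring_on R\<^esub> L" if "s \<in> J \<cdot>\<^bsub>ring_on R\<^esub> L" "a \<in> R" for a s
    using that(1)
  proof (induct rule: ideal_prod_induct)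
    case (mult y z)
    then have "(a * y) * z \<in> J \<cdot>\<^bsub>ring_on R\<^esub> L"
      using ideal_prod_mult submodD(4)[OF J that(2)] by blast
    then show ?case by (simp add: mult.assoc)
  qed (simp add: distrib_left ideal_prod_add)
  moreover have "- s \<in> J \<cdot>\<^bsub>ring_on R\<^esub> L" if "s \<in> J \<cdot>\<^bsub>ring_on R\<^esub> L" for s
    using smult[OF that uminus_R[OF one_R]] by simp
  moreover have "0 \<in> J \<cdot>\<^bsub>ring_on R\<^esub> L"
    using ideal_prod_mult[OF submodD(1)[OF J] submodD(1)[OF L]] by simp
  ultimately show ?thesis using ideal_prod_add by (simp add: submod_iff)
qed

lemma submod_P: "submod R (P n)"
  by (induct n) (auto intro: submod_R submod_ideal_prod submod_I)

lemma P_filt: "I \<subseteq> filt k \<Longrightarrow> P n \<subseteq> filt (int n * k)"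
proof (induct n)
  case (Suc n)
  have "s \<in> filt (int (Suc n) * k)" if "s \<in> I \<cdot>\<^bsub>ring_on R\<^esub> P n" for s
    using that
  proof (induct rule: ideal_prod_induct)
    case (mult y z)
    then show ?case using filt_mult[of y k z "int n * k"] Suc by (auto simp: algebra_simps)
  qed (rule filt_add)
  then show ?case by auto
qed (use R_filt in simp)

lemma P_R: "P n \<subseteq> R"
proof (induct n)
  case (Suc n)
  have "s \<in> R" if "s \<in> I \<cdot>\<^bsub>ring_on R\<^esub> P n" for s
    using that
  proof (induct rule: ideal_prod_induct)
    case (mult y z)
    then show ?case using Suc I_R mult_R by blast
  qed (rule add_R)
  then show ?case by auto
qed simp

lemma power_P: "x \<in> I \<Longrightarrow> x ^ n \<in> P n"
  by (induct n) (auto simp: one_R intro: ideal_prod_mult)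

lemma P_mult: "y \<in> P m \<Longrightarrow> z \<in> P n \<Longrightarrow> y * z \<in> P (m + n)"
proof (induct m arbitrary: y)
  case 0
  then show ?case using submodD(4)[OF submod_P] by simp
next
  case (Suc m)
  from Suc.prems(1) have "y \<in> I \<cdot>\<^bsub>ring_on R\<^esub> P m" by simp
  then show ?case
  proof (induct rule: ideal_prod_induct)
    case (mult i j)
    then show ?case using ideal_prod_mult[of i I "j * z" "P (m + n)"] Suc by (simp add: mult.assoc)
  next
    case (add i j)
    then show ?case using ideal_prod_add by (simp add: distrib_right)
  qed
qed

lemma fractional_P: "fractional (P n)"
proof -
  obtain x where "x \<in> I" "x \<noteq> 0" using I_nz by blast
  then show ?thesis
    using fractional_nonzero_submod[OF submod_P, of n 0 "x ^ n"] P_R R_filt power_P by auto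
qed

lemma scale_scale: "(*) y ` (*) z ` J = (*) (y * z) ` (J :: 'a set)"
  by (simp add: image_image mult.assoc)

text \<open>
  An element \<open>x\<close> of least value in \<open>I\<close> is a minimal reduction: the modules \<open>x\<^sup>-\<^sup>n I\<^sup>n\<close> ascend inside
  the integral closure, so the lengths of the quotients above them are eventually constant.
\<close>

lemma minimal_reduction_exists: "\<exists>x. minimal_reduction R I x"
proof -
  obtain y where y: "y \<in> I" "y \<noteq> 0" using I_nz by blast
  obtain x where x: "x \<in> I \<and> x \<noteq> 0" "\<And>w. w \<in> I \<and> w \<noteq> 0 \<Longrightarrow> nat (v x) \<le> nat (v w)"
    using ex_has_least_nat[of "\<lambda>w. w \<in> I \<and> w \<noteq> 0" y "\<lambda>w. nat (v w)"] y by blast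
  have nonneg: "0 \<le> v w" if "w \<in> I" "w \<noteq> 0" for w
    using R_filt I_R that filt_iff by blast
  have I_x: "I \<subseteq> filt (v x)"
  proof
    fix w assume w: "w \<in> I"
    show "w \<in> filt (v x)"
    proof (cases "w = 0")
      case False
      then have "nat (v x) \<le> nat (v w)" "0 \<le> v w" using x(2) nonneg w by auto
      then show ?thesis using False by (simp add: filt_iff)
    qed simp
  qed
  define J where "J n = (*) (inverse (x ^ n)) ` P n" for n
  have xn: "inverse (x ^ n) \<noteq> 0" for n using x by simp
  have fJ: "fractional (J n)" for n
    unfolding J_def by (rule fractional_scale[OF xn fractional_P])
  have J_filt: "J n \<subseteq> filt 0" for n
  proof -
    have "J n \<subseteq> (*) (inverse (x ^ n)) ` filt (int n * v x)"
      unfolding J_def by (intro image_mono P_filt I_x)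
    then show ?thesis using filt_scale[OF xn] x by (simp add: v_inverse v_power)
  qed
  have J_Suc: "J n \<subseteq> J (Suc n)" for n
  proof
    fix w assume "w \<in> J n"
    then obtain p where p: "p \<in> P n" "w = inverse (x ^ n) * p" by (auto simp: J_def)
    have "x * p \<in> P (Suc n)" using p x ideal_prod_mult by simp
    moreover have "w = inverse (x ^ Suc n) * (x * p)" using p x by simp
    ultimately show "w \<in> J (Suc n)" by (auto simp: J_def)
  qed
  define f where "f n = mod_length R (filt 0) (J n)" for n
  have f_Suc: "f n = f (Suc n) + mod_length R (J (Suc n)) (J n)" for n
    unfolding f_def by (rule mod_length_trans) (use fJ J_filt J_Suc fractional_filt in auto)
  obtain N where N: "\<And>n. f N \<le> f n"
    using ex_has_least_nat[of "\<lambda>_. True" 0 f] by blast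
  have f_N: "f n = f N" if "n \<ge> N" for n
    using that
  proof (induct rule: dec_induct)
    case (step n)
    then show ?case using f_Suc[of n] N[of "Suc n"] by simp
  qed simp
  have "P (Suc n) = (*) x ` P n" if n: "n \<ge> N" for n
  proof -
    have "mod_length R (J (Suc n)) (J n) = 0" using f_Suc[of n] f_N[OF n] f_N[of "Suc n"] n by linarith
    then have "J (Suc n) = J n" by (rule mod_length_0[OF fJ fJ J_Suc])
    then have "(*) (x ^ Suc n) ` J (Suc n) = (*) (x ^ Suc n) ` J n" by simp
    moreover have xx: "x ^ Suc n * inverse (x ^ Suc n) = 1" "x ^ Suc n * inverse (x ^ n) = x"
      using x by (simp_all add: field_simps)
    have "(*) (x ^ Suc n) ` J (Suc n) = P (Suc n)" "(*) (x ^ Suc n) ` J n = (*) x ` P n"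
      unfolding J_def scale_scale xx by simp_all
    ultimately show ?thesis by simp
  qed
  then show ?thesis using x unfolding minimal_reduction_def by blast
qed

definition x :: 'a where "x = some_reduction R I"

definition \<nu> :: nat where "\<nu> = reduction_exponent R I"

definition \<Lambda> :: "'a set" where "\<Lambda> = blowup R I"

lemma minimal_reduction_x: "minimal_reduction R I x"
  unfolding x_def some_reduction_def by (rule someI_ex[OF minimal_reduction_exists])

lemma x_I: "x \<in> I"
  using minimal_reduction_x by (simp add: minimal_reduction_def)

lemma P_Suc_reduction: "n \<ge> \<nu> \<Longrightarrow> P (Suc n) = (*) x ` P n"
proof -
  have "\<exists>N. \<forall>n\<ge>N. P (Suc n) = (*) x ` P n"
    using minimal_reduction_x by (auto simp: minimal_reduction_def)
  then have "\<forall>n\<ge>\<nu>. P (Suc n) = (*) x ` P n"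
    unfolding \<nu>_def reduction_exponent_def x_def by (rule LeastI_ex)
  then show "n \<ge> \<nu> \<Longrightarrow> P (Suc n) = (*) x ` P n" by blast
qed

lemma x_nz: "x \<noteq> 0"
  using P_Suc_reduction[of \<nu>] fractional_not_zero[OF fractional_P[of "Suc \<nu>"]] by auto

lemma v_x: "0 \<le> v x"
  using x_I I_R R_filt x_nz filt_iff by blast

lemma colon_P_mono: "m \<le> n \<Longrightarrow> colon (P m) (P m) \<subseteq> colon (P n) (P n)"
proof (induct rule: dec_induct)
  case (step n)
  have "y * s \<in> P (Suc n)" if y: "y \<in> colon (P n) (P n)" and "s \<in> I \<cdot>\<^bsub>ring_on R\<^esub> P n" for y s
    using that(2)
  proof (induct rule: ideal_prod_induct)
    case (mult i j)
    then have "i * (y * j) \<in> P (Suc n)" using y ideal_prod_mult by (simp add: colon_def)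
    then show ?case by (simp add: mult.left_commute)
  next
    case (add i j)
    then show ?case using submodD(2)[OF submod_P] by (metis distrib_left)
  qed
  then have "colon (P n) (P n) \<subseteq> colon (P (Suc n)) (P (Suc n))" by (auto simp: colon_def)
  then show ?case using step by blast
qed simp

text \<open>
  The module \<open>S = x\<^sup>-\<^sup>\<nu> I\<^sup>\<nu>\<close> equals \<open>x\<^sup>-\<^sup>n I\<^sup>n\<close> for all \<open>n \<ge> \<nu>\<close>. Taking \<open>n = 2\<nu>\<close> gives \<open>S S \<subseteq> S\<close>, so \<open>S\<close> is a
  ring, hence \<open>S : S = S\<close>, and \<open>S = I\<^sup>n : I\<^sup>n\<close> for all large \<open>n\<close>.
\<close>

lemma blowup_ring: "y \<in> \<Lambda> \<Longrightarrow> z \<in> \<Lambda> \<Longrightarrow> y * z \<in> \<Lambda>" "1 \<in> \<Lambda>"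
  and P_eq: "P \<nu> = (*) (x ^ \<nu>) ` \<Lambda>"
proof -
  define S where "S = (*) (inverse (x ^ \<nu>)) ` P \<nu>"
  have P_S: "P n = (*) (x ^ n) ` S" if "n \<ge> \<nu>" for n
    using that
  proof (induct rule: dec_induct)
    case base
    then show ?case using x_nz by (simp add: S_def scale_scale)
  next
    case (step n)
    then show ?case using P_Suc_reduction[of n] by (simp add: scale_scale)
  qed
  have S_mult: "y * z \<in> S" if "y \<in> S" "z \<in> S" for y z
  proof -
    have "(x ^ \<nu> * y) * (x ^ \<nu> * z) \<in> P (\<nu> + \<nu>)" using that P_S[of \<nu>] by (intro P_mult) auto
    then obtain s where "s \<in> S" "(x ^ \<nu> * y) * (x ^ \<nu> * z) = x ^ (\<nu> + \<nu>) * s"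
      using P_S[of "\<nu> + \<nu>"] by auto
    then show ?thesis using x_nz by (simp add: power_add mult.assoc mult.left_commute)
  qed
  have S_1: "1 \<in> S"
    unfolding S_def using power_P[OF x_I, of \<nu>] x_nz by (auto intro!: image_eqI[of _ _ "x ^ \<nu>"])
  have colon_P: "colon (P n) (P n) = S" if "n \<ge> \<nu>" for n
  proof
    show "S \<subseteq> colon (P n) (P n)"
      using S_mult x_nz by (auto simp: P_S[OF that] colon_def image_iff mult.left_commute)
    show "colon (P n) (P n) \<subseteq> S"
    proof
      fix y assume "y \<in> colon (P n) (P n)"
      moreover have "x ^ n \<in> P n" using power_P[OF x_I] .
      ultimately have "y * x ^ n \<in> P n" by (simp add: colon_def)
      then have "y * x ^ n \<in> (*) (x ^ n) ` S" using P_S[OF that] by blast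
      then show "y \<in> S" using x_nz by (auto simp: mult.commute)
    qed
  qed
  have "\<Lambda> = S"
  proof
    have "colon (P n) (P n) \<subseteq> S" for n
      using colon_P_mono[of n "max n \<nu>"] colon_P[of "max n \<nu>"] by simp
    then show "\<Lambda> \<subseteq> S" unfolding \<Lambda>_def blowup_def by blast
    show "S \<subseteq> \<Lambda>" unfolding \<Lambda>_def blowup_def using colon_P[of \<nu>] by blast
  qed
  then show "y \<in> \<Lambda> \<Longrightarrow> z \<in> \<Lambda> \<Longrightarrow> y * z \<in> \<Lambda>" "1 \<in> \<Lambda>" "P \<nu> = (*) (x ^ \<nu>) ` \<Lambda>"
    using S_mult S_1 P_S[of \<nu>] by auto
qed

lemma fractional_\<Lambda>: "fractional \<Lambda>"
proof -
  have "\<Lambda> = (*) (inverse (x ^ \<nu>)) ` P \<nu>"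
    using x_nz by (simp add: P_eq scale_scale)
  moreover have "fractional ((*) (inverse (x ^ \<nu>)) ` P \<nu>)"
    by (rule fractional_scale[OF _ fractional_P]) (simp add: x_nz)
  ultimately show ?thesis by simp
qed

lemma R_\<Lambda>: "R \<subseteq> \<Lambda>"
  using submodD(4)[OF fractional_submod[OF fractional_\<Lambda>] _ blowup_ring(2)] by auto

text \<open>The powers of an element of \<open>\<Lambda>\<close> have bounded denominators, so its value is not negative.\<close>

lemma \<Lambda>_filt: "\<Lambda> \<subseteq> filt 0"
proof
  fix y assume y: "y \<in> \<Lambda>"
  obtain l where l: "\<Lambda> \<subseteq> filt l" using fractional_\<Lambda> by (auto simp: fractional_def)
  have pow: "y ^ n \<in> \<Lambda>" for n by (induct n) (use y blowup_ring in auto)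
  show "y \<in> filt 0"
  proof (rule ccontr)
    assume "y \<notin> filt 0"
    then have ny: "y \<noteq> 0" "v y < 0" by (auto simp: filt_def)
    \<comment> \<open>chosen so that \<open>- n < l\<close>\<close>
    define n where "n = nat (\<bar>l\<bar> + 1)"
    have "int n * v y \<le> int n * (-1)" using ny by (intro mult_left_mono) auto
    moreover have "y ^ n \<in> filt l" using pow l by blast
    then have "l \<le> int n * v y" using ny by (simp add: filt_iff v_power)
    ultimately show False unfolding n_def by simp
  qed
qed

lemma mod_length_R_principal: "mod_length R R ((*) x ` R) = nat (v x)"
  using x_I I_R mult_R by (intro mod_length_scale_self x_nz v_x fractional_R) auto

lemma mod_length_\<Lambda>_P: "mod_length R \<Lambda> (P \<nu>) = multiplicity_of R I * \<nu>"
proof -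
  have "mod_length R \<Lambda> (P \<nu>) = nat (v (x ^ \<nu>))"
    unfolding P_eq
  proof (rule mod_length_scale_self)
    show "(*) (x ^ \<nu>) ` \<Lambda> \<subseteq> \<Lambda>"
      using P_R[of \<nu>] R_\<Lambda> by (simp add: P_eq)
  qed (use x_nz v_x fractional_\<Lambda> in \<open>auto simp: v_power\<close>)
  also have "\<dots> = \<nu> * nat (v x)" using v_x x_nz by (simp add: v_power nat_mult_distrib)
  finally show ?thesis
    using mod_length_R_principal by (simp add: multiplicity_of_def x_def)
qed

abbreviation q :: "'a set" where "q \<equiv> colon R \<Lambda>"

lemma fractional_q: "fractional q"
  by (intro fractional_colon fractional_R fractional_\<Lambda>)

lemma q_R: "q \<subseteq> R"
  using blowup_ring(2) by (force simp: colon_def)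

lemma conductor_q: "filt (int conductor) \<subseteq> q"
  using colon_antimono[OF \<Lambda>_filt, of R] by (simp add: colon_filt_conductor)

lemma P_q: "P \<nu> \<subseteq> q"
proof
  fix y assume "y \<in> P \<nu>"
  then obtain z where z: "z \<in> \<Lambda>" "y = x ^ \<nu> * z" by (auto simp: P_eq)
  have "y * w \<in> P \<nu>" if "w \<in> \<Lambda>" for w
    unfolding P_eq z(2) mult.assoc using blowup_ring(1)[OF z(1) that] by (rule imageI)
  then show "y \<in> q" using P_R by (auto simp: colon_def)
qed

lemma \<Lambda>_bidual: "\<Lambda> \<subseteq> bidual R \<Lambda>"
  by (auto simp: bidual_def colon_def mult.commute)

lemma fractional_bidual: "fractional (bidual R \<Lambda>)"
  unfolding bidual_def by (intro fractional_colon fractional_R fractional_q)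

lemma bidual_filt: "bidual R \<Lambda> \<subseteq> filt 0"
  using colon_antimono[OF conductor_q, of R] by (simp add: bidual_def colon_R_filt)

lemma Gam_eq: "Gam R t \<Lambda> = value_indices q"
  by (simp add: Gam_def value_indices_def)

lemma d_inv_eq: "d_inv R t \<Lambda> =
  int (mod_length R (filt 0) (bidual R \<Lambda>)) - int (\<Sum>i\<in>value_indices q. type_seq R t i)"
  by (simp add: d_inv_def Gam_eq int_closure_filt)

lemma d_inv_nonneg: "0 \<le> d_inv R t \<Lambda>"
  using sum_type_seq_value_indices_le[OF fractional_q q_R conductor_q]
  by (simp only: d_inv_eq bidual_def)

text \<open>
  The chain \<open>I\<^sup>\<nu> \<subseteq> q \<subseteq> R \<subseteq> \<Lambda>\<close> gives \<open>\<rho> = e \<nu> - l(R/q) - l(q/I\<^sup>\<nu>)\<close>, and the chain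
  \<open>R \<subseteq> \<Lambda> \<subseteq> \<Lambda>\<^sup>*\<^sup>* \<subseteq> R'\<close> gives \<open>\<rho> = r\<^sub>1 + \<dots> + r\<^sub>n - l(R'/\<Lambda>\<^sup>*\<^sup>*) - l(\<Lambda>\<^sup>*\<^sup>*/\<Lambda>)\<close>; the formula is their sum.
\<close>

lemma genus_formula:
  "2 * int (genus R I) = int (multiplicity_of R I) * int \<nu>
     + (\<Sum>i\<in>{1..ts_length R} - Gam R t \<Lambda>. (int (type_seq R t i) - 1)) - d_inv R t \<Lambda>
     - int (mod_length R (bidual R \<Lambda>) \<Lambda>) - int (mod_length R q (P \<nu>))"
proof -
  let ?G = "value_indices q" and ?n = "ts_length R"
  have G: "?G \<subseteq> {1..?n}" by (auto simp: value_indices_def)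
  have 1: "mod_length R \<Lambda> (P \<nu>) = genus R I + mod_length R R (P \<nu>)"
    unfolding genus_def \<Lambda>_def[symmetric]
    by (intro mod_length_trans fractional_P fractional_R fractional_\<Lambda> P_R R_\<Lambda>)
  have 2: "mod_length R R (P \<nu>) = mod_length R R q + mod_length R q (P \<nu>)"
    by (intro mod_length_trans fractional_P fractional_R fractional_q P_q q_R)
  have 3: "mod_length R R q = card ({1..?n} - ?G)"
    by (rule mod_length_R_ideal[OF fractional_q q_R conductor_q])
  have 4: "mod_length R (filt 0) R = mod_length R (filt 0) \<Lambda> + genus R I"
    unfolding genus_def \<Lambda>_def[symmetric]
    by (intro mod_length_trans fractional_filt fractional_R fractional_\<Lambda> \<Lambda>_filt R_\<Lambda>)
  have 5: "mod_length R (filt 0) \<Lambda> =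
      mod_length R (filt 0) (bidual R \<Lambda>) + mod_length R (bidual R \<Lambda>) \<Lambda>"
    by (intro mod_length_trans fractional_filt fractional_bidual fractional_\<Lambda> \<Lambda>_bidual bidual_filt)
  have "(\<Sum>i\<in>{1..?n}. type_seq R t i) =
      (\<Sum>i\<in>{1..?n} - ?G. type_seq R t i) + (\<Sum>i\<in>?G. type_seq R t i)"
    by (rule sum.subset_diff[OF G]) simp
  then have 6: "mod_length R (filt 0) R =
      (\<Sum>i\<in>{1..?n} - ?G. type_seq R t i) + (\<Sum>i\<in>?G. type_seq R t i)"
    by (simp only: sum_type_seq)
  have 7: "(\<Sum>i\<in>{1..?n} - ?G. (int (type_seq R t i) - 1)) =
      int (\<Sum>i\<in>{1..?n} - ?G. type_seq R t i) - int (card ({1..?n} - ?G))"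
    by (simp add: sum_subtractf)
  have 8: "int (mod_length R \<Lambda> (P \<nu>)) = int (multiplicity_of R I) * int \<nu>"
    by (simp add: mod_length_\<Lambda>_P)
  show ?thesis
    unfolding Gam_eq d_inv_eq 7 8[symmetric] using 1 2 3 4 5 6 by linarith
qed

text \<open>If \<open>R : \<Lambda> = x\<^sup>\<nu> \<Lambda>\<close>, then \<open>R : (R : \<Lambda>) = x\<^sup>-\<^sup>\<nu> (R : \<Lambda>) = \<Lambda>\<close>.\<close>

lemma bidual_eq:
  assumes "q = P \<nu>"
  shows "bidual R \<Lambda> = \<Lambda>"
proof
  show "bidual R \<Lambda> \<subseteq> \<Lambda>"
  proof
    fix y assume "y \<in> bidual R \<Lambda>"
    then have "y * (x ^ \<nu> * z) \<in> R" if "z \<in> \<Lambda>" for z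
      using that assms by (auto simp: bidual_def colon_def P_eq)
    then have "y * x ^ \<nu> \<in> P \<nu>" by (simp add: colon_def mult.assoc flip: assms)
    then show "y \<in> \<Lambda>" using x_nz by (auto simp: P_eq mult.commute)
  qed
qed (rule \<Lambda>_bidual)

lemma genus_equality_iff:
  "2 * int (genus R I) = int (multiplicity_of R I) * int \<nu>
      + (\<Sum>i\<in>{1..ts_length R} - Gam R t \<Lambda>. (int (type_seq R t i) - 1))
    \<longleftrightarrow> q = P \<nu> \<and> d_inv R t \<Lambda> = 0" (is "?lhs \<longleftrightarrow> ?rhs")
proof
  assume ?lhs
  then have "mod_length R q (P \<nu>) = 0" "d_inv R t \<Lambda> = 0"
    using genus_formula d_inv_nonneg by linarith+
  then show ?rhs using mod_length_0[OF fractional_P fractional_q P_q] by blast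
next
  assume r: ?rhs
  then have "mod_length R (bidual R \<Lambda>) \<Lambda> = 0" "mod_length R q (P \<nu>) = 0"
    using bidual_eq mod_length_self fractional_\<Lambda> fractional_P by auto
  then show ?lhs using genus_formula r by linarith
qed

end

section \<open>The valuation of a discrete valuation ring\<close>

lemma ring_on_simps [simp]:
  "carrier (ring_on A) = A" "x \<otimes>\<^bsub>ring_on A\<^esub> y = x * y" "\<one>\<^bsub>ring_on A\<^esub> = 1"
  "\<zero>\<^bsub>ring_on A\<^esub> = 0" "x \<oplus>\<^bsub>ring_on A\<^esub> y = x + y"
  by (simp_all add: ring_on_def)

lemma subringD:
  assumes "ring (ring_on A)"
  shows "0 \<in> A" "1 \<in> A" "a \<in> A \<Longrightarrow> b \<in> A \<Longrightarrow> a + b \<in> A" "a \<in> A \<Longrightarrow> b \<in> A \<Longrightarrow> a * b \<in> A"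
    "a \<in> A \<Longrightarrow> - a \<in> A"
proof -
  interpret ring "ring_on A" by (rule assms)
  show "0 \<in> A" "1 \<in> A" "a \<in> A \<Longrightarrow> b \<in> A \<Longrightarrow> a + b \<in> A" "a \<in> A \<Longrightarrow> b \<in> A \<Longrightarrow> a * b \<in> A"
    using zero_closed one_closed a_closed[of a b] m_closed[of a b] by simp_all
  assume "a \<in> A"
  then have "\<ominus>\<^bsub>ring_on A\<^esub> a \<in> A" "a + \<ominus>\<^bsub>ring_on A\<^esub> a = 0"
    using a_inv_closed[of a] r_neg[of a] by simp_all
  then show "- a \<in> A" by (simp add: add_eq_0_iff)
qed

lemma Units_ring_on: "Units (ring_on A) = {u \<in> A. u \<noteq> 0 \<and> inverse u \<in> A}"
proof -
  have "w = inverse u \<and> u \<noteq> 0" if "w * u = 1" for u w :: 'a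
    using that by (metis inverse_unique mult.commute mult_zero_right zero_neq_one)
  then have "Units (ring_on A) \<subseteq> {u \<in> A. u \<noteq> 0 \<and> inverse u \<in> A}" by (auto simp: Units_def)
  moreover have "u \<in> Units (ring_on A)" if "u \<in> A" "u \<noteq> 0" "inverse u \<in> A" for u
    using that by (auto simp: Units_def intro!: bexI[of _ "inverse u"])
  ultimately show ?thesis by blast
qed

lemma PIdl_ring_on: "PIdl\<^bsub>ring_on A\<^esub> a = (\<lambda>x. x * a) ` A"
  by (auto simp: cgenideal_def)

locale dvr_in_field =
  fixes B :: "'a::field set" and t :: 'a
  assumes dvr: "dvr (ring_on B)" and unif: "uniformizer (ring_on B) t"
begin

abbreviation U :: "'a set" where "U \<equiv> Units (ring_on B)"

sublocale principal_domain "ring_on B"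
  using dvr by (simp add: dvr_def)

lemmas B_closed = subringD[OF ring_axioms]

lemma t_B: "t \<in> B"
  using unif by (simp add: uniformizer_def)

lemma t_nz: "t \<noteq> 0"
proof
  assume "t = 0"
  then have "maximalideal {\<zero>\<^bsub>ring_on B\<^esub>} (ring_on B)"
    using unif B_closed(1) by (auto simp: uniformizer_def PIdl_ring_on image_constant_conv split: if_splits)
  then show False using zeromaximalideal_fieldI dvr by (simp add: dvr_def)
qed

lemma inverse_t: "inverse t \<notin> B"
proof
  assume t: "inverse t \<in> B"
  have "B \<subseteq> PIdl\<^bsub>ring_on B\<^esub> t"
    unfolding PIdl_ring_on
  proof
    fix b assume "b \<in> B"
    then show "b \<in> (\<lambda>x. x * t) ` B"
      using t t_nz B_closed(4) by (intro image_eqI[of _ _ "b * inverse t"]) auto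
  qed
  then have "PIdl\<^bsub>ring_on B\<^esub> t = B"
    using B_closed(4) t_B by (auto simp: PIdl_ring_on)
  then show False using unif maximalideal.I_notcarr by (fastforce simp: uniformizer_def)
qed

text \<open>
  A non-unit has an irreducible divisor, which generates a maximal ideal; in a local ring this is
  the ideal generated by \<open>t\<close>.
\<close>

lemma nonunit_div_t:
  assumes "b \<in> B" "b \<notin> U"
  shows "b / t \<in> B"
proof (cases "b = 0")
  case False
  then have b: "b \<in> carrier (ring_on B) - {\<zero>\<^bsub>ring_on B\<^esub>}" using assms(1) by simp
  obtain p where pc: "p \<in> carrier (ring_on B)"
    and p: "ring_irreducible\<^bsub>ring_on B\<^esub> p" "p divides\<^bsub>ring_on B\<^esub> b"
    by (rule exists_irreducible_divisor[OF b assms(2)])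
  have "maximalideal (PIdl\<^bsub>ring_on B\<^esub> p) (ring_on B)"
    by (rule irreducible_imp_maximalideal[OF pc p(1)])
  then have "PIdl\<^bsub>ring_on B\<^esub> p = PIdl\<^bsub>ring_on B\<^esub> t"
    using dvr unif unfolding dvr_def local_with_def uniformizer_def by blast
  then have "p \<in> (\<lambda>x. x * t) ` B"
    using cgenideal_self[OF pc] by (simp only: PIdl_ring_on)
  then obtain a where a: "a \<in> B" "p = a * t" by blast
  obtain c where c: "c \<in> B" "b = p * c" using p(2) by (auto simp: factor_def)
  then have "b / t = a * c" using a t_nz by simp
  then show ?thesis using a c B_closed(4) by simp
qed (simp add: B_closed)

text \<open>
  If all \<open>b / t\<^sup>k\<close> were in \<open>B\<close>, the ideals they generate would ascend. A generator \<open>g\<close> of the union of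
  these ideals lies in one of them, so \<open>b / t\<^sup>k\<^sup>+\<^sup>1\<close> is a multiple of \<open>b / t\<^sup>k\<close> in \<open>B\<close> for some \<open>k\<close>, and \<open>t\<close>
  would be a unit.
\<close>

lemma power_not_dividing:
  assumes "b \<in> B" "b \<noteq> 0"
  shows "\<exists>k. b / t ^ k \<notin> B"
proof (rule ccontr)
  assume "\<not> ?thesis"
  then have all: "b / t ^ k \<in> B" for k by blast
  define J where "J = {c * (b / t ^ k) | c k. c \<in> B}"
  \<comment> \<open>raises denominators, so that two elements of \<open>J\<close> can be added over the common \<open>t\<^sup>k\<^sup>+\<^sup>m\<close>\<close>
  have up: "c * (b / t ^ k) = (c * t ^ m) * (b / t ^ (k + m))" for c k m
    using t_nz by (simp add: power_add)
  have t_pow: "t ^ m \<in> B" for m by (induct m) (auto simp: B_closed t_B)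
  have "ideal J (ring_on B)"
  proof (rule idealI)
    show "ring (ring_on B)" by (rule ring_axioms)
    show "subgroup J (add_monoid (ring_on B))"
    proof (rule add.subgroupI)
      show "J \<subseteq> carrier (ring_on B)" using all B_closed(4) unfolding J_def by fastforce
      show "J \<noteq> {}" using B_closed(1) by (auto simp: J_def)
    next
      fix y assume y: "y \<in> J"
      then obtain c k where c: "c \<in> B" "y = c * (b / t ^ k)" by (auto simp: J_def)
      have yB: "y \<in> B" unfolding c(2) by (rule B_closed(4)[OF c(1) all])
      have "- y = (- c) * (b / t ^ k)" "- c \<in> B" using c B_closed(5) by auto
      then have "- y \<in> J" unfolding J_def by blast
      moreover have "\<ominus>\<^bsub>ring_on B\<^esub> y = - y"
        by (rule minus_equality) (use yB B_closed(5)[OF yB] in simp_all)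
      ultimately show "\<ominus>\<^bsub>ring_on B\<^esub> y \<in> J" by simp
    next
      fix y z assume "y \<in> J" "z \<in> J"
      then obtain c k d m where *: "c \<in> B" "y = c * (b / t ^ k)" "d \<in> B" "z = d * (b / t ^ m)"
        unfolding J_def by blast
      have "y + z = (c * t ^ m + d * t ^ k) * (b / t ^ (k + m))"
        using up[of c k m] up[of d m k] * by (simp add: distrib_right add_divide_distrib add.commute)
      moreover have "c * t ^ m + d * t ^ k \<in> B" using * B_closed t_pow by simp
      ultimately show "y \<oplus>\<^bsub>ring_on B\<^esub> z \<in> J" unfolding J_def by auto
    qed
  next
    fix y a assume "y \<in> J" and a: "a \<in> carrier (ring_on B)"
    then obtain c k where "c \<in> B" "y = c * (b / t ^ k)" by (auto simp: J_def)
    then have "a * y = (a * c) * (b / t ^ k)" "a * c \<in> B" using a B_closed(4) by auto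
    then have "a * y \<in> J" unfolding J_def by blast
    then show "a \<otimes>\<^bsub>ring_on B\<^esub> y \<in> J" "y \<otimes>\<^bsub>ring_on B\<^esub> a \<in> J" by (simp_all add: mult.commute)
  qed
  then obtain g where g: "g \<in> B" "J = (\<lambda>x. x * g) ` B"
    using exists_gen[of J] by (auto simp: PIdl_ring_on)
  have "1 * g \<in> J" using g(2) B_closed(2) by blast
  then obtain c k where c: "c \<in> B" "g = c * (b / t ^ k)" by (auto simp: J_def)
  have "1 * (b / t ^ Suc k) \<in> J" using B_closed(2) unfolding J_def by blast
  then obtain a where a: "a \<in> B" "b / t ^ Suc k = a * g" using g(2) by auto
  then have "inverse t = a * c"
    using c assms t_nz by (simp add: field_simps)
  then show False using inverse_t a c B_closed(4) by simp
qed

lemma decompose_B: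
  assumes "b \<in> B" "b \<noteq> 0"
  shows "\<exists>k. \<exists>u\<in>U. b = u * t ^ k"
proof -
  obtain k where k: "b / t ^ k \<notin> B" "\<And>m. m < k \<Longrightarrow> b / t ^ m \<in> B"
    using power_not_dividing[OF assms] exists_least_iff[of "\<lambda>k. b / t ^ k \<notin> B"] by auto
  have "k \<noteq> 0" using k(1) assms(1) by (intro notI) simp
  then obtain m where m: "k = Suc m" using not0_implies_Suc by blast
  have "b / t ^ m / t \<notin> B" using k(1) m by (simp add: mult.commute)
  then have "b / t ^ m \<in> U" using nonunit_div_t k(2)[of m] m by blast
  moreover have "b = b / t ^ m * t ^ m" using t_nz by simp
  ultimately show ?thesis by blast
qed

lemma U_mult: "u \<in> U \<Longrightarrow> w \<in> U \<Longrightarrow> u * w \<in> U"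
  by (auto simp: Units_ring_on B_closed)

lemma U_inverse: "u \<in> U \<Longrightarrow> inverse u \<in> U"
  by (auto simp: Units_ring_on)

lemma U_1: "1 \<in> U"
  by (auto simp: Units_ring_on B_closed)

lemma t_powi_B: "0 \<le> k \<Longrightarrow> t powi k \<in> B"
proof -
  have "t ^ m \<in> B" for m by (induct m) (auto simp: B_closed t_B)
  then show "0 \<le> k \<Longrightarrow> t powi k \<in> B" by (simp add: power_int_def)
qed

lemma unit_powi_in_B_iff: "u \<in> U \<Longrightarrow> u * t powi k \<in> B \<longleftrightarrow> 0 \<le> k"
proof
  assume u: "u \<in> U"
  show "0 \<le> k \<Longrightarrow> u * t powi k \<in> B" using u t_powi_B B_closed(4) by (auto simp: Units_ring_on)
  assume "u * t powi k \<in> B"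
  then have *: "t powi k \<in> B"
    using u B_closed(4)[of "inverse u" "u * t powi k"]
    by (auto simp: Units_ring_on simp flip: mult.assoc)
  show "0 \<le> k"
  proof (rule ccontr)
    assume "\<not> 0 \<le> k"
    then have "t powi (- 1 - k) * t powi k \<in> B" using * t_powi_B[of "- 1 - k"] B_closed(4) by simp
    moreover have "t powi (- 1 - k) * t powi k = inverse t"
      using t_nz power_int_add[of t "- 1 - k" k] by (simp add: power_int_minus)
    ultimately show False using inverse_t by simp
  qed
qed

lemma unit_powi_unique:
  assumes "u \<in> U" "w \<in> U" "u * t powi j = w * t powi k"
  shows "j = k"
proof -
  have le: "j \<le> k" if "u \<in> U" "w \<in> U" "u * t powi j = w * t powi k" for u w j k
  proof -
    have "1 = (inverse u * w) * t powi (k - j)"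
      using that t_nz by (simp add: power_int_diff Units_ring_on field_simps)
    then have "(inverse u * w) * t powi (k - j) \<in> B" using B_closed(2) by metis
    then show ?thesis using unit_powi_in_B_iff U_mult U_inverse that by fastforce
  qed
  show ?thesis using le[OF assms] le[OF assms(2,1) assms(3)[symmetric]] by simp
qed

end

section \<open>Analytic irreducibility and residual rationality\<close>

text \<open>
  If \<open>w\<close> is a common denominator of the generators of \<open>N\<close>, then \<open>{y. w y \<in> R}\<close> is a submodule that
  contains the generators, hence contains \<open>N\<close>.
\<close>

lemma common_denominator:
  assumes R: "ring (ring_on R)" and fin: "finite_module R N" and quot: "quotient_field_is_UNIV R"
  shows "\<exists>w. w \<noteq> 0 \<and> (\<forall>b\<in>N. w * b \<in> R)"
proof -
  note cl = subringD[OF R]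
  obtain G where G: "finite G" "N = \<Inter>{H. submod R H \<and> G \<subseteq> H}"
    using fin by (auto simp: finite_module_def)
  have "\<exists>w. w \<in> R \<and> w \<noteq> 0 \<and> (\<forall>b\<in>G. w * b \<in> R)"
    using G(1)
  proof (induct G)
    case empty
    then show ?case using cl(2) by (intro exI[of _ 1]) auto
  next
    case (insert g G)
    then obtain w where w: "w \<in> R" "w \<noteq> 0" "\<forall>b\<in>G. w * b \<in> R" by blast
    obtain a c where ac: "a \<in> R" "c \<in> R" "c \<noteq> 0" "g = a / c"
      using quot unfolding quotient_field_is_UNIV_def by blast
    have "(c * w) * b \<in> R" if "b \<in> insert g G" for b
    proof (cases "b = g")
      case True
      then have "(c * w) * b = a * w" using ac by simp
      then show ?thesis using cl(4)[OF ac(1) w(1)] by (simp only:)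
    next
      case False
      then have "c * (w * b) \<in> R" using that w ac cl(4) by blast
      then show ?thesis by (simp add: mult.assoc)
    qed
    then show ?case using w ac cl(4) by (intro exI[of _ "c * w"]) simp
  qed
  then obtain w where w: "w \<noteq> 0" "\<forall>b\<in>G. w * b \<in> R" by blast
  have "submod R {y. w * y \<in> R}"
    unfolding submod_iff using cl by (auto simp: distrib_left mult.left_commute[of w])
  then have "N \<subseteq> {y. w * y \<in> R}" using G w by auto
  then show ?thesis using w by blast
qed

lemma subset_int_closure:
  assumes "ring (ring_on R)"
  shows "R \<subseteq> int_closure R"
proof
  fix a assume a: "a \<in> R"
  note cl = subringD[OF assms]
  have "Polynomial.coeff [:- a, 1:] i \<in> R" for i
    using a cl by (auto simp: coeff_pCons split: nat.splits)
  then show "a \<in> int_closure R"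
    unfolding int_closure_def by (intro CollectI exI[of _ "[:- a, 1:]"]) auto
qed

lemma set_add_ring_on: "C <+>\<^bsub>ring_on A\<^esub> D = C + D"
  by (auto simp: set_add_defs set_plus_def)

lemma carrier_Quot_ring_on: "carrier (ring_on A Quot N) = (\<lambda>a. (\<lambda>n. n + a) ` N) ` A"
  by (auto simp: FactRing_def A_RCOSETS_def' a_r_coset_def' UNION_singleton_eq_range)

text \<open>Surjectivity of the map of residue fields, for elements instead of cosets.\<close>

lemma residually_rational_surj:
  assumes rr: "residually_rational R M t" and M: "M \<subseteq> R" and R: "ring (ring_on R)"
    and B: "ring (ring_on (int_closure R))" and b: "b \<in> int_closure R"
  shows "\<exists>a\<in>R. \<exists>c\<in>int_closure R. b = a + c * t"
proof -
  let ?B = "ring_on (int_closure R)"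
  let ?N = "(\<lambda>x. x * t) ` int_closure R"
  note clR = subringD[OF R] and clB = subringD[OF B]
  have "(\<lambda>C. C + ?N) ` carrier (ring_on R Quot M) = carrier (?B Quot ?N)"
    using rr
    by (simp add: residually_rational_def Let_def ring_iso_def bij_betw_def set_add_ring_on PIdl_ring_on)
  moreover have "(\<lambda>n. n + b) ` ?N \<in> carrier (?B Quot ?N)"
    unfolding carrier_Quot_ring_on using b by (rule imageI)
  ultimately have "(\<lambda>n. n + b) ` ?N \<in> (\<lambda>C. C + ?N) ` carrier (ring_on R Quot M)" by (simp only:)
  then obtain C where C: "C \<in> carrier (ring_on R Quot M)" "(\<lambda>n. n + b) ` ?N = C + ?N"
    by (rule imageE)
  have "C \<subseteq> R" using C(1) M clR(3) by (auto simp: carrier_Quot_ring_on)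
  have "0 * t + b \<in> (\<lambda>n. n + b) ` ?N" by (intro imageI clB(1))
  then have "b \<in> C + ?N" using C(2) by (simp only: mult_zero_left add_0_left)
  then show ?thesis using \<open>C \<subseteq> R\<close> by (blast elim: set_plus_elim)
qed

lemma branch_if_analytically_irreducible:
  fixes R M :: "'a::field set" and t :: 'a
  assumes R: "domain (ring_on R)" and quot: "quotient_field_is_UNIV R"
    and ai: "analytically_irreducible R" and unif: "uniformizer (ring_on (int_closure R)) t"
    and rr: "residually_rational R M t" and M: "M \<subseteq> R"
  shows "branch R t"
proof -
  let ?B = "int_closure R"
  interpret dvr_in_field ?B t
    using ai unif by unfold_locales (simp_all add: analytically_irreducible_def)
  have ringR: "ring (ring_on R)" using R by (simp add: domain_def cring_def)
  note cl = subringD[OF ringR]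
  have RB: "R \<subseteq> ?B" by (rule subset_int_closure[OF ringR])
  have val_unit: "val R t (u * t powi k) = k" if "u \<in> U" for u k
    unfolding val_def using that unit_powi_unique by (intro the_equality) auto
  have ex: "\<exists>k. \<exists>u\<in>U. y = u * t powi k" if "y \<noteq> 0" for y
  proof -
    obtain a b where ab: "a \<in> R" "b \<in> R" "b \<noteq> 0" "y = a / b"
      using quot unfolding quotient_field_is_UNIV_def by blast
    then have "a \<in> ?B" "b \<in> ?B" "a \<noteq> 0" using RB that by auto
    then obtain i j u w where *: "u \<in> U" "w \<in> U" "a = u * t ^ i" "b = w * t ^ j"
      using decompose_B[of a] decompose_B[of b] ab(3) by blast
    have "y = (u * inverse w) * t powi (int i - int j)"
      using ab * t_nz by (simp add: power_int_diff divide_inverse)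
    then show ?thesis using U_mult U_inverse * by blast
  qed
  have mult: "val R t (y * z) = val R t y + val R t z" if "y \<noteq> 0" "z \<noteq> 0" for y z
  proof -
    obtain i j u w where *: "u \<in> U" "w \<in> U" "y = u * t powi i" "z = w * t powi j"
      using ex \<open>y \<noteq> 0\<close> \<open>z \<noteq> 0\<close> by meson
    then have "y * z = (u * w) * t powi (i + j)"
      using t_nz by (simp add: power_int_add)
    then show ?thesis using * val_unit U_mult by metis
  qed
  have in_B: "y \<in> ?B \<longleftrightarrow> 0 \<le> val R t y" if nz: "y \<noteq> 0" for y
    using ex[OF nz] val_unit unit_powi_in_B_iff by metis
  have add: "val R t y \<le> val R t (y + z)"
    if nz: "y \<noteq> 0" "z \<noteq> 0" "y + z \<noteq> 0" and le: "val R t y \<le> val R t z" for y z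
  proof -
    have "val R t (y * (z / y)) = val R t y + val R t (z / y)" using nz by (intro mult) auto
    then have "z / y \<in> ?B" using nz le in_B[of "z / y"] by simp
    then have "1 + z / y \<in> ?B" using B_closed by blast
    moreover have ne: "1 + z / y \<noteq> 0" using nz by (simp add: field_simps)
    ultimately have "0 \<le> val R t (1 + z / y)" using in_B by blast
    moreover have "y + z = y * (1 + z / y)" using nz by (simp add: field_simps)
    ultimately show ?thesis using mult[OF nz(1) ne] by simp
  qed
  show ?thesis
  proof
    show "0 \<in> R" "1 \<in> R" by (rule cl)+
    show "a + b \<in> R" "a * b \<in> R" if "a \<in> R" "b \<in> R" for a b using cl that by auto
    show "- a \<in> R" if "a \<in> R" for a using cl that by auto
    show "t \<noteq> 0" by (rule t_nz)
    show "val R t t = 1" using val_unit[OF U_1, of 1] by simp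
    show "R \<subseteq> ?B" by (rule RB)
    have "y \<in> ?B \<longleftrightarrow> y = 0 \<or> 0 \<le> val R t y" for y
      by (cases "y = 0") (simp_all add: in_B B_closed(1))
    then show "?B = {y. y = 0 \<or> 0 \<le> val R t y}" by blast
    show "\<exists>w. w \<noteq> 0 \<and> (\<forall>b\<in>?B. w * b \<in> R)"
      using common_denominator[OF ringR _ quot] ai by (simp add: analytically_irreducible_def)
    show "val R t (y * z) = val R t y + val R t z" if "y \<noteq> 0" "z \<noteq> 0" for y z
      by (rule mult[OF that])
    show "min (val R t y) (val R t z) \<le> val R t (y + z)" if "y \<noteq> 0" "z \<noteq> 0" "y + z \<noteq> 0" for y z
      using add[of y z] add[of z y] that by (simp add: add.commute) linarith
    show "\<exists>a\<in>R. b = a \<or> 1 \<le> val R t (b - a)" if b: "b \<in> ?B" for b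
    proof -
      obtain a c where ac: "a \<in> R" "c \<in> ?B" "b = a + c * t"
        using residually_rational_surj[OF rr M ringR ring_axioms b] by blast
      have "1 \<le> val R t (c * t)" if "c \<noteq> 0"
        using mult[OF that t_nz] val_unit[OF U_1, of 1] in_B[OF that] ac by simp
      then show ?thesis using ac by (intro bexI[of _ a]) auto
    qed
  qed
qed


section \<open>The genus formula\<close>

theorem theorem4p7:
  fixes R M I \<Lambda> :: "'a::field set" and t :: 'a and e \<nu> \<rho> n :: nat and r :: "nat \<Rightarrow> nat"
    and \<Gamma> :: "nat set" and d :: int
  assumes "noetherian_domain (ring_on R)"
    and "quotient_field_is_UNIV R"
    and "local_with (ring_on R) M"
    and "krull_dim (ring_on R) = 1"
    and "infinite (carrier (ring_on R Quot M))"
    and "analytically_irreducible R"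
    and "uniformizer (ring_on (int_closure R)) t"
    and "residually_rational R M t"
    and "primary_to R M I"
    and "\<not> principalideal I (ring_on R)"
    and "\<Lambda> = blowup R I"
    and "e = multiplicity_of R I"
    and "\<nu> = reduction_exponent R I"
    and "\<rho> = genus R I"
    and "n = ts_length R"
    and "r = type_seq R t"
    and "\<Gamma> = Gam R t \<Lambda>"
    and "d = d_inv R t \<Lambda>"
  shows "2 * int \<rho> = int e * int \<nu> + (\<Sum>i\<in>{1..n} - \<Gamma>. (int (r i) - 1)) - d
           - int (mod_length R (bidual R \<Lambda>) \<Lambda>)
           - int (mod_length R (colon R \<Lambda>) (ideal_power R I \<nu>))
       \<and> (2 * int \<rho> = int e * int \<nu> + (\<Sum>i\<in>{1..n} - \<Gamma>. (int (r i) - 1))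
          \<longleftrightarrow> colon R \<Lambda> = ideal_power R I \<nu> \<and> d = 0)"
proof -
  have dom: "domain (ring_on R)" using assms(1) by (simp add: noetherian_domain_def)
  then have ringR: "ring (ring_on R)" by (simp add: domain_def cring_def)
  have M: "M \<subseteq> R" and I: "ideal I (ring_on R)" using assms(9) by (auto simp: primary_to_def)
  interpret branch R t
    by (rule branch_if_analytically_irreducible[OF dom assms(2,6,7,8) M])
  have I_R: "I \<subseteq> R" using ideal.Icarr[OF I] by auto
  have smult: "a * y \<in> I" if "a \<in> R" "y \<in> I" for a y
    using ideal.I_l_closed[OF I, of y a] that by simp
  have I_sub: "submod R I"
    unfolding submod_iff
  proof (intro conjI ballI)
    show "0 \<in> I"
      using additive_subgroup.zero_closed[OF ideal.axioms(1)[OF I]] by simp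
    show "y + z \<in> I" if "y \<in> I" "z \<in> I" for y z
      using additive_subgroup.a_closed[OF ideal.axioms(1)[OF I], of y z] that by simp
    show "- y \<in> I" if "y \<in> I" for y
      using smult[OF uminus_R[OF one_R] that] by simp
  qed (rule smult)
  \<comment> \<open>the zero ideal is principal\<close>
  have "I \<noteq> {0}"
    using ring.zeropideal[OF ringR] assms(10) by auto
  then have I_nz: "\<exists>y\<in>I. y \<noteq> 0" using submodD(1)[OF I_sub] by blast
  interpret branch_ideal R t I
    by (intro branch_ideal.intro branch_ideal_axioms.intro branch_axioms I_sub I_R I_nz)
  show ?thesis
    unfolding assms(11-18)
    using genus_formula genus_equality_iff unfolding \<Lambda>_def \<nu>_def by (rule conjI)
qed

end
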